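(* Let $q\ge 6$ be a prime power and let $\bar{\mathcal C}$ be an $\mathbb F_q$-conic of $\mathrm{PG}(2,q^3)$. Then in the Bruck-Bose representation in $\mathrm{PG}(6,q)$, $[\mathcal C]$ is a $k$-dimensional normal rational curve with $k=2$, $3$, $4$ or $6$.
   Context: **$\mathbb F_q$-conics.** An $\mathbb F_q$-subplane of $\mathrm{PG}(2,q^3)$ is a subplane of order $q$; an $\mathbb F_q$-conic is a non-degenerate conic of an $\mathbb F_q$-subplane. **Normal rational curves.** A $k$-dimensional normal rational curve in $\mathrm{PG}(n,q)$ is a set of points lying in a $k$-space and projectively equivalent to $\{(1,\theta,\dots,\theta^k):\theta\in\mathbb F_q\}\cup\{(0,\dots,0,1)\}$. **Regular 2-spread.** $X^q$ is obtained from $X$ by raising coordinates to the $q$-th power. A regular 2-spread $\mathcal S$ of $\Sigma_\infty\cong\mathrm{PG}(5,q)$ is obtained from a line $g$ of $\mathrm{PG}(5,q^3)$ disjoint from $\Sigma_\infty$ such that $g,g^q,g^{q^2}$ span $\mathrm{PG}(5,q^3)$: its elements are the planes $\langle X,X^q,X^{q^2}\rangle\cap\Sigma_\infty$, $X\in g$. **Bruck-Bose representation.** Let $\Sigma_\infty$ be a hyperplane of $\mathrm{PG}(6,q)$ and $\mathcal S$ a regular 2-spread of $\Sigma_\infty$. The incidence structure whose points are the points of $\mathrm{PG}(6,q)\setminus\Sigma_\infty$ (affine points) and the planes of $\mathcal S$; whose lines are the 3-spaces of $\mathrm{PG}(6,q)$ not contained in $\Sigma_\infty$ that contain a plane of $\mathcal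 S$, together with the line at infinity $\ell_\infty$ (the set of planes of $\mathcal S$); with incidence induced by $\mathrm{PG}(6,q)$, is isomorphic to $\mathrm{PG}(2,q^3)$. $[\mathcal C]$ denotes the representation of $\bar{\mathcal C}$ in $\mathrm{PG}(6,q)$. The usual Bruck-Bose convention is used: the representation is not required to be exact at infinity, and linear components contained in $\Sigma_\infty$ (or an extension of it) are ignored. Thus "$[\mathcal C]$ is a $k$-dimensional normal rational curve" means that there is a $k$-dimensional normal rational curve of $\mathrm{PG}(6,q)$ whose affine points are exactly the affine points representing the points of $\bar{\mathcal C}\setminus\ell_\infty$. *)

theory Defs
  imports "HOL-Analysis.Analysis"
begin

text \<open>
  A subspace of the projective space over a field is represented by the corresponding vector
  subspace of \<open>'a ^ 'n\<close>, so that incidence is inclusion and \<open>PG(n,q)\<close> has \<open>n + 1\<close> coordinates.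
  An incidence structure is represented by its set of points and its set of lines, each line being
  the set of points incident with it.
\<close>

definition pg_spaces :: "nat \<Rightarrow> ('a::field ^ 'n) set set" where
  "pg_spaces k = {U. vec.subspace U \<and> vec.dim U = k + 1}"

definition pg_points :: "('a::field ^ 'n) set set" where
  "pg_points = pg_spaces 0"

definition pg_lines :: "('a::field ^ 'n) set set set" where
  "pg_lines = {{P \<in> pg_points. P \<subseteq> L} | L. L \<in> pg_spaces 1}"

definition incidence_iso ::
  "('p \<Rightarrow> 'r) \<Rightarrow> 'p set \<Rightarrow> 'p set set \<Rightarrow> 'r set \<Rightarrow> 'r set set \<Rightarrow> bool" where
  "incidence_iso f P L P' L' \<longleftrightarrow> bij_betw f P P' \<and> (\<lambda>l. f ` l) ` L = L'"

definition projective_plane_of_order :: "nat \<Rightarrow> 'p set \<Rightarrow> 'p set set \<Rightarrow> bool" where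
  "projective_plane_of_order n P L \<longleftrightarrow>
     (\<forall>l\<in>L. l \<subseteq> P) \<and>
     (\<forall>x\<in>P. \<forall>y\<in>P. x \<noteq> y \<longrightarrow> (\<exists>!l. l \<in> L \<and> x \<in> l \<and> y \<in> l)) \<and>
     (\<forall>l\<in>L. \<forall>m\<in>L. l \<noteq> m \<longrightarrow> (\<exists>!x. x \<in> l \<and> x \<in> m)) \<and>
     (\<exists>A\<subseteq>P. card A = 4 \<and> (\<forall>l\<in>L. card (l \<inter> A) \<le> 2)) \<and>
     (\<forall>l\<in>L. card l = n + 1)"


section \<open>Conics of subplanes\<close>

text \<open>
  The lines of a subplane with point set \<open>B\<close> are the lines of the ambient plane that join two of
  its points, restricted to \<open>B\<close>.
\<close>

definition subplane_lines ::
  "('b::{field,finite} ^ 3) set set \<Rightarrow> ('b ^ 3) set set set" where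
  "subplane_lines B = {l \<inter> B | l. l \<in> pg_lines \<and> 2 \<le> card (l \<inter> B)}"

definition subplane_of_order ::
  "nat \<Rightarrow> ('b::{field,finite} ^ 3) set set \<Rightarrow> bool" where
  "subplane_of_order n B \<longleftrightarrow>
     B \<subseteq> pg_points \<and> projective_plane_of_order n B (subplane_lines B)"

definition quadratic_form :: "('a::field ^ 'n \<Rightarrow> 'a) \<Rightarrow> bool" where
  "quadratic_form Q \<longleftrightarrow>
     (\<exists>c::'n \<Rightarrow> 'n \<Rightarrow> 'a. \<forall>x. Q x = (\<Sum>i\<in>UNIV. \<Sum>j\<in>UNIV. c i j * x $ i * x $ j))"

text \<open>
  A singular vector is one at which the form and all its partial derivatives vanish; the derivative
  at \<open>v\<close> in direction \<open>w\<close> is the polar form below. Requiring \<open>Q v = 0\<close> separately matters only in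
  characteristic 2. Since finite fields are perfect, it makes no difference whether singular
  vectors are sought over the field itself or over its algebraic closure.
\<close>

definition nondegenerate_form :: "('a::{field,finite} ^ 'n \<Rightarrow> 'a) \<Rightarrow> bool" where
  "nondegenerate_form Q \<longleftrightarrow>
     \<not> (\<exists>v. v \<noteq> 0 \<and> Q v = 0 \<and> (\<forall>w. Q (v + w) - Q v - Q w = 0))"

definition zero_locus :: "('a::field ^ 'n \<Rightarrow> 'a) \<Rightarrow> ('a ^ 'n) set set" where
  "zero_locus Q = {P \<in> pg_points. \<forall>v\<in>P. Q v = 0}"

definition nondegenerate_conic :: "('a::{field,finite} ^ 3) set set \<Rightarrow> bool" where
  "nondegenerate_conic D \<longleftrightarrow>
     (\<exists>Q. quadratic_form Q \<and> nondegenerate_form Q \<and> D = zero_locus Q)"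

text \<open>
  Here \<open>'a\<close> is the field with \<open>q\<close> elements. The conics of a subplane of order \<open>q\<close> are the
  images of those of \<open>PG(2,q)\<close> under an isomorphism \<open>\<psi>\<close>; as the automorphisms of \<open>PG(2,q)\<close>
  permute its non-degenerate conics, the choice of \<open>\<psi>\<close> is irrelevant.
\<close>

definition Fq_conic ::
  "'a::{field,finite} itself \<Rightarrow> ('b::{field,finite} ^ 3) set set \<Rightarrow> bool" where
  "Fq_conic _ C \<longleftrightarrow>
     (\<exists>B (\<psi> :: ('a ^ 3) set \<Rightarrow> ('b ^ 3) set) D.
        subplane_of_order CARD('a) B \<and>
        incidence_iso \<psi> pg_points pg_lines B (subplane_lines B) \<and>
        nondegenerate_conic D \<and> C = \<psi> ` D)"


section \<open>Normal rational curves\<close>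

text \<open>
  A projectivity from \<open>PG(k,q)\<close> onto a \<open>k\<close>-space \<open>U\<close> is given by the images \<open>b 0, \<dots>, b k\<close> of the
  standard basis vectors, which may be any basis of \<open>U\<close>. It sends the point with homogeneous
  coordinates \<open>(c 0, \<dots>, c k)\<close> to \<open>point_of_coords k b c\<close>.
\<close>

definition point_of_coords ::
  "nat \<Rightarrow> (nat \<Rightarrow> 'a::field ^ 'n) \<Rightarrow> (nat \<Rightarrow> 'a) \<Rightarrow> ('a ^ 'n) set" where
  "point_of_coords k b c = vec.span {\<Sum>i\<le>k. c i *s b i}"

definition normal_rational_curve :: "nat \<Rightarrow> ('a::field ^ 'n) set set \<Rightarrow> bool" where
  "normal_rational_curve k N \<longleftrightarrow>
     (\<exists>U\<in>pg_spaces k. \<exists>b.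
        inj_on b {..k} \<and> vec.independent (b ` {..k}) \<and> vec.span (b ` {..k}) = U \<and>
        N = point_of_coords k b `
              ({\<lambda>i. \<theta> ^ i | \<theta>. True} \<union> {\<lambda>i. if i = k then 1 else 0}))"


section \<open>Regular spreads and the Bruck-Bose plane\<close>

definition field_embedding :: "('a::field \<Rightarrow> 'b::field) \<Rightarrow> bool" where
  "field_embedding \<iota> \<longleftrightarrow>
     \<iota> 1 = 1 \<and> (\<forall>x y. \<iota> (x + y) = \<iota> x + \<iota> y) \<and> (\<forall>x y. \<iota> (x * y) = \<iota> x * \<iota> y)"

definition map_coords :: "('a \<Rightarrow> 'b) \<Rightarrow> 'a ^ 'n \<Rightarrow> 'b ^ 'n" where
  "map_coords f v = (\<chi> i. f (v $ i))"

definition frob :: "nat \<Rightarrow> ('b::field ^ 'n) set \<Rightarrow> ('b ^ 'n) set" where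
  "frob m U = map_coords (\<lambda>x. x ^ m) ` U"

text \<open>
  \<open>'a\<close> has \<open>q\<close> elements, \<open>'b\<close> has \<open>q\<^sup>3\<close> elements, and \<open>\<iota>\<close> embeds the former in the latter, so that
  \<open>PG(5,q)\<close> lies in \<open>PG(5,q\<^sup>3)\<close>. The elements of the spread are the planes
  \<open>\<langle>X, X\<^sup>q, X\<^bsup>q\<^sup>2\<^esup>\<rangle> \<inter> PG(5,q)\<close>.
\<close>

definition regular_2_spread_PG5 ::
  "('a::{field,finite} \<Rightarrow> 'b::{field,finite}) \<Rightarrow> ('a ^ 6) set set \<Rightarrow> bool" where
  "regular_2_spread_PG5 \<iota> S \<longleftrightarrow>
     (\<exists>g\<in>pg_spaces 1.
        (\<forall>v. v \<noteq> 0 \<longrightarrow> map_coords \<iota> v \<notin> g) \<and>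
        vec.span (g \<union> frob CARD('a) g \<union> frob (CARD('a)\<^sup>2) g) = UNIV \<and>
        S = {{v. map_coords \<iota> v \<in> vec.span (X \<union> frob CARD('a) X \<union> frob (CARD('a)\<^sup>2) X)} | X.
               X \<in> pg_points \<and> X \<subseteq> g})"

text \<open>
  A hyperplane \<open>H\<close> of \<open>PG(6,q)\<close> is identified with \<open>PG(5,q)\<close> by a linear bijection \<open>T\<close>; since
  the Frobenius map commutes with linear maps over \<open>GF(q)\<close>, the resulting set of spreads does not
  depend on \<open>T\<close>.
\<close>

definition regular_2_spread ::
  "('a::{field,finite} \<Rightarrow> 'b::{field,finite}) \<Rightarrow> ('a ^ 7) set \<Rightarrow> ('a ^ 7) set set \<Rightarrow> bool" where
  "regular_2_spread \<iota> H S \<longleftrightarrow>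
     (\<exists>T S0. Vector_Spaces.linear (*s) (*s) T \<and> inj T \<and> range T = H \<and>
        regular_2_spread_PG5 \<iota> S0 \<and> S = (\<lambda>\<pi>. T ` \<pi>) ` S0)"

definition affine_points :: "('a::field ^ 7) set \<Rightarrow> ('a ^ 7) set set" where
  "affine_points H = {P \<in> pg_points. \<not> P \<subseteq> H}"

definition bb_points :: "('a::field ^ 7) set \<Rightarrow> ('a ^ 7) set set \<Rightarrow> ('a ^ 7) set set" where
  "bb_points H S = affine_points H \<union> S"

definition bb_lines :: "('a::field ^ 7) set \<Rightarrow> ('a ^ 7) set set \<Rightarrow> ('a ^ 7) set set set" where
  "bb_lines H S =
     {{P \<in> bb_points H S. P \<subseteq> L} | L. L \<in> pg_spaces 3 \<and> \<not> L \<subseteq> H \<and> (\<exists>\<pi>\<in>S. \<pi> \<subseteq> L)} \<union> {S}"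

definition bruck_bose_iso ::
  "('a::field ^ 7) set \<Rightarrow> ('a ^ 7) set set \<Rightarrow> (('a ^ 7) set \<Rightarrow> ('b::field ^ 3) set) \<Rightarrow> bool" where
  "bruck_bose_iso H S \<phi> \<longleftrightarrow>
     incidence_iso \<phi> (bb_points H S) (bb_lines H S) pg_points pg_lines"

text \<open>
  The line at infinity of \<open>PG(2,q\<^sup>3)\<close> is \<open>\<phi> ` S\<close>. Only affine points are compared: the
  representation need not be exact at infinity.
\<close>

definition bb_affine_rep ::
  "('a::field ^ 7) set \<Rightarrow> ('a ^ 7) set set \<Rightarrow> (('a ^ 7) set \<Rightarrow> ('b::field ^ 3) set) \<Rightarrow>
     ('b ^ 3) set set \<Rightarrow> ('a ^ 7) set set" where
  "bb_affine_rep H S \<phi> C = {P \<in> affine_points H. \<phi> P \<in> C - \<phi> ` S}"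

definition bb_represents_nrc ::
  "nat \<Rightarrow> ('a::field ^ 7) set \<Rightarrow> ('a ^ 7) set set \<Rightarrow> (('a ^ 7) set \<Rightarrow> ('b::field ^ 3) set) \<Rightarrow>
     ('b ^ 3) set set \<Rightarrow> bool" where
  "bb_represents_nrc k H S \<phi> C \<longleftrightarrow>
     (\<exists>N. normal_rational_curve k N \<and> N \<inter> affine_points H = bb_affine_rep H S \<phi> C)"

end

(*
  In suitable coordinates the affine points of PG(6,q) are the points (x, y, 1) with x, y in GF(q^3),
  and the spread is the set of one-dimensional GF(q^3)-subspaces of the hyperplane. By the fundamental
  theorem of projective geometry the conic has a parametrization t |-> a0 + t a1 + t^2 a2 with
  t in GF(q) and linearly independent vectors a0, a1, a2 over GF(q^3), where a2 is an affine point.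
  Its last coordinate g is a monic quadratic polynomial over GF(q^3). Multiplying the parametrization
  by the least polynomial p for which g p has coefficients in GF(q) gives a polynomial curve in the
  GF(q)-space, of degree k = 2 + deg p. Comparing the roots of g with those of its conjugates
  g', g'' leaves four cases: p is 1 (g rational), a linear factor (g = l l'' with l not rational),
  a product of two conjugate linear factors (g has exactly one rational root), or g' g'' (g and g'
  coprime). In each case a GF(q)-linear functional that vanishes on the coefficients of the curve
  annihilates all polynomials of degree at most k, so the k + 1 coefficient vectors are independent.
*)

theory Submission imports Defs "HOL-Computational_Algebra.Polynomial" begin

section \<open>Finite fields and their cubic extensions\<close>

text \<open>The isomorphisms \<open>\<phi>\<close> and \<open>\<psi>\<close> are arbitrary, so
  neither is known in coordinates. Together with the canonical identification
  \<open>bb_point\<close> they form one map from PG(2,q) to PG(2,q^3), and the fundamental theorem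
  is proved for such embeddings. The field embedding it yields may differ from
  \<open>\<iota>\<close>, but both have the fixed field of Frobenius as image, so the parameter runs
  through the same subfield. Taking a2 affine puts an affine point of the conic at parameter
  infinity: g has degree exactly 2, and the leading coefficient vector of the cleared curve is a2
  itself. An empty affine part is matched by a curve inside \<open>H\<close>. Independence rests on
  Galois conjugation: a functional with values in GF(q) that kills X^i p for i <= 2 also kills X^i
  p' and X^i p''. Common roots need only be sought in GF(q^3): distinct monic quadratics differ by a
  polynomial of degree at most 1, whose root lies in the field. If g is irrational and shares a root
  with g', it splits over GF(q^3) and deg p is 1 or 2; if it shares none, deg p is 4. This is why k
  = 5 is absent.\<close>

lemma finite_field_power_card:
  fixes x :: "'a::{field,finite}"
  shows "x ^ CARD('a) = x"
proof (cases "x = 0")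
  case True
  then show ?thesis by (simp add: zero_power)
next
  case False
  let ?U = "UNIV - {0::'a}"
  have bij: "bij_betw ((*) x) ?U ?U"
    by (rule bij_betwI[where g = "\<lambda>y. y / x"]) (use False in auto)
  have "prod id ?U = (\<Prod>y\<in>?U. x * y)"
    using prod.reindex_bij_betw[OF bij, of id] by simp
  also have "\<dots> = x ^ card ?U * prod id ?U"
    by (simp add: prod.distrib)
  finally have "x ^ card ?U = 1"
    by simp
  moreover have "CARD('a) = Suc (card ?U)"
    by (simp add: card_Suc_Diff1)
  ultimately show ?thesis by (metis mult_1_right power_Suc)
qed

locale cubic_extension =
  fixes \<iota> :: "'a::{field,finite} \<Rightarrow> 'b::{field,finite}"
  assumes card_ext: "CARD('b) = CARD('a) ^ 3"
    and embedding: "field_embedding \<iota>"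
begin

lemma iota_one [simp]: "\<iota> 1 = 1"
  and iota_add: "\<iota> (x + y) = \<iota> x + \<iota> y"
  and iota_mult: "\<iota> (x * y) = \<iota> x * \<iota> y"
  using embedding by (simp_all add: field_embedding_def)

lemma iota_zero [simp]: "\<iota> 0 = 0"
  using iota_add[of 0 0] by (metis add_0 add_cancel_right_left)

lemma iota_minus: "\<iota> (- x) = - \<iota> x"
  using iota_add[of x "- x"] by (simp add: eq_neg_iff_add_eq_0 add.commute)

lemma iota_diff: "\<iota> (x - y) = \<iota> x - \<iota> y"
  using iota_add[of x "- y"] by (simp add: iota_minus)

lemma iota_eq_0_iff [simp]: "\<iota> x = 0 \<longleftrightarrow> x = 0"
  using iota_mult[of x "inverse x"] by (cases "x = 0") auto

lemma inj_iota: "inj \<iota>"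
  by (rule injI) (metis iota_diff iota_eq_0_iff right_minus_eq)

lemma iota_eq_iff [simp]: "\<iota> x = \<iota> y \<longleftrightarrow> x = y"
  using inj_iota by (auto dest: injD)

lemma iota_power: "\<iota> (x ^ n) = \<iota> x ^ n"
  by (induction n) (simp_all add: iota_mult)

lemma iota_of_nat: "\<iota> (of_nat n) = of_nat n"
  by (induction n) (simp_all add: iota_add)

lemma card_base_gt_1: "1 < CARD('a)"
proof -
  have "card {0::'a, 1} \<le> CARD('a)"
    by (rule card_mono) auto
  then show ?thesis by simp
qed

section \<open>The Frobenius automorphism of GF(q^3) over GF(q)\<close>

definition fr :: "'b \<Rightarrow> 'b" where
  "fr x = x ^ CARD('a)"

lemma fr_mult: "fr (x * y) = fr x * fr y"
  by (simp add: fr_def power_mult_distrib)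

lemma fr_zero [simp]: "fr 0 = 0"
  by (simp add: fr_def zero_power)

lemma fr_one [simp]: "fr 1 = 1"
  by (simp add: fr_def)

lemma fr_iota [simp]: "fr (\<iota> x) = \<iota> x"
  by (simp add: fr_def finite_field_power_card flip: iota_power)

lemma fr_fr_fr [simp]: "fr (fr (fr x)) = x"
proof -
  have "fr (fr (fr x)) = x ^ (CARD('a) ^ 3)"
    by (simp add: fr_def power3_eq_cube mult.assoc flip: power_mult)
  then show ?thesis
    by (metis card_ext finite_field_power_card)
qed

text \<open>The binomial coefficients are the coefficients of \<open>(X + 1)\<^sup>q - X\<^sup>q - 1\<close>, which vanishes on
  the whole field but has degree less than \<open>q\<close>.\<close>

lemma binomial_card_eq_0:
  assumes "0 < i" and "i < CARD('a)"
  shows "of_nat (CARD('a) choose i) = (0::'a)"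
proof -
  let ?q = "CARD('a)"
  define P :: "'a poly" where "P = (\<Sum>i\<in>{1..<?q}. monom (of_nat (?q choose i)) i)"
  have deg: "degree P < ?q"
    unfolding P_def using card_base_gt_1
    by (intro le_less_trans[OF degree_sum_le[where n = "?q - 1"]])
      (auto intro: degree_monom_le[THEN order_trans])
  have "poly P x = 0" for x
  proof -
    have "{..?q} = insert 0 (insert ?q {1..<?q})"
      using card_base_gt_1 by auto
    then have "(x + 1) ^ ?q = 1 + (x ^ ?q + (\<Sum>i\<in>{1..<?q}. of_nat (?q choose i) * x ^ i))"
      using card_base_gt_1 by (simp add: binomial_ring)
    then show ?thesis
      by (simp add: finite_field_power_card P_def poly_sum poly_monom)
  qed
  then have "{x. poly P x = 0} = UNIV"
    by auto
  then have "P = 0"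
    using card_poly_roots_bound[of P] deg by force
  then have "coeff P i = 0" by simp
  then show ?thesis
    using assms by (simp add: P_def coeff_sum coeff_monom sum.delta)
qed

text \<open>The binomial coefficients vanish in GF(q), and \<open>\<iota>\<close> carries this to
  GF(q^3); the characteristic never has to be named.\<close>

lemma fr_add: "fr (x + y) = fr x + fr y"
proof -
  let ?q = "CARD('a)"
  have zero: "of_nat (?q choose i) = (0::'b)" if "i \<in> {1..<?q}" for i
    using binomial_card_eq_0[of i] that iota_of_nat by (metis One_nat_def Suc_le_eq atLeastLessThan_iff iota_zero)
  have "{..?q} = insert 0 (insert ?q {1..<?q})"
    using card_base_gt_1 by auto
  then have "(x + y) ^ ?q = y ^ ?q + (x ^ ?q + (\<Sum>i\<in>{1..<?q}. of_nat (?q choose i) * x ^ i * y ^ (?q - i)))"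
    using card_base_gt_1 by (simp add: binomial_ring)
  also have "(\<Sum>i\<in>{1..<?q}. of_nat (?q choose i) * x ^ i * y ^ (?q - i)) = 0"
    using zero by (intro sum.neutral) simp
  finally show ?thesis by (simp add: fr_def)
qed

lemma fr_minus: "fr (- x) = - fr x"
  using fr_add[of x "- x"] by (simp add: eq_neg_iff_add_eq_0 add.commute)

lemma fr_diff: "fr (x - y) = fr x - fr y"
  using fr_add[of x "- y"] by (simp add: fr_minus)

lemma fr_eq_iff [simp]: "fr x = fr y \<longleftrightarrow> x = y"
  by (metis fr_fr_fr)

text \<open>By counting: X^q - X has at most q roots, and the q elements of the image are roots. The
  right-hand side depends on q only, so every embedding of GF(q) has the same image.\<close>

lemma range_iota: "range \<iota> = {x. fr x = x}"
proof (rule card_seteq)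
  let ?q = "CARD('a)"
  let ?P = "monom 1 ?q - monom 1 1 :: 'b poly"
  have "coeff ?P ?q = 1"
    using card_base_gt_1 by (simp add: coeff_monom)
  then have "?P \<noteq> 0" by (metis coeff_0 zero_neq_one)
  moreover have "degree ?P \<le> ?q"
    using card_base_gt_1 by (intro degree_diff_le) (auto intro: degree_monom_le[THEN order_trans])
  moreover have "{x. fr x = x} = {x. poly ?P x = 0}"
    by (simp add: poly_monom fr_def)
  ultimately have "card {x. fr x = x} \<le> ?q"
    using card_poly_roots_bound[of ?P] by simp
  then show "card {x. fr x = x} \<le> card (range \<iota>)"
    by (simp add: card_image inj_iota)
qed auto

lemma fr_fixed_iff: "fr x = x \<longleftrightarrow> x \<in> range \<iota>"
  by (simp add: range_iota)

end

section \<open>Clearing denominators of a quadratic polynomial\<close>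

text \<open>In polynomial terms: a linear functional vanishing on \<open>X\<^sup>i * g\<close> and \<open>X\<^sup>i * h\<close> for \<open>i \<le> m\<close>,
  where \<open>g\<close> and \<open>h\<close> are coprime monic quadratics, vanishes on all polynomials of degree
  at most \<open>m + 2\<close>.\<close>

lemma two_recurrences_imp_zero:
  fixes \<mu> :: "nat \<Rightarrow> 'b::field"
  assumes m: "1 \<le> m"
    and rec_c: "\<And>i. i \<le> m \<Longrightarrow> \<mu> (i + 2) + c1 * \<mu> (i + 1) + c0 * \<mu> i = 0"
    and rec_d: "\<And>i. i \<le> m \<Longrightarrow> \<mu> (i + 2) + d1 * \<mu> (i + 1) + d0 * \<mu> i = 0"
    and ne: "(c0, c1) \<noteq> (d0, d1)"
    and no_root: "\<And>\<alpha>. \<alpha> ^ 2 + c1 * \<alpha> + c0 = 0 \<Longrightarrow> \<alpha> ^ 2 + d1 * \<alpha> + d0 \<noteq> 0"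
    and i: "i \<le> m + 2"
  shows "\<mu> i = 0"
proof -
  \<comment> \<open>The difference of the two recurrences has order one, or order zero if
    \<open>d1 = c1\<close>.\<close>
  have lin: "(d1 - c1) * \<mu> (i + 1) + (d0 - c0) * \<mu> i = 0" if "i \<le> m" for i
    using rec_c[OF that] rec_d[OF that] by algebra
  have low: "\<mu> i = 0" if "i \<le> m" for i
  proof (cases "d1 = c1")
    case True
    then show ?thesis using lin[OF that] ne by auto
  next
    case False
    \<comment> \<open>The root of the linear polynomial h - g, hence the only candidate for a common
      root of g and h.\<close>
    define \<alpha> where "\<alpha> = - (d0 - c0) / (d1 - c1)"
    have \<alpha>: "(d1 - c1) * \<alpha> + (d0 - c0) = 0"
      using False by (simp add: \<alpha>_def)
    have step: "\<mu> (i + 1) = \<alpha> * \<mu> i" if "i \<le> m" for i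
    proof -
      have "(d1 - c1) * \<mu> (i + 1) = (d1 - c1) * (\<alpha> * \<mu> i)"
        using lin[OF that] \<alpha> by algebra
      then show ?thesis using False by simp
    qed
    have "\<alpha> ^ 2 + c1 * \<alpha> + c0 \<noteq> 0"
    proof
      assume "\<alpha> ^ 2 + c1 * \<alpha> + c0 = 0"
      moreover from this have "\<alpha> ^ 2 + d1 * \<alpha> + d0 = 0"
        using \<alpha> by algebra
      ultimately show False using no_root by blast
    qed
    \<comment> \<open>\<open>\<mu>\<close> is geometric with ratio \<open>\<alpha>\<close>, so its
      recurrence at 0 says that g(\<alpha>) annihilates \<open>\<mu> 0\<close>. Using
      \<open>step\<close> at 1 needs \<open>1 \<le> m\<close>.\<close>
    moreover have "(\<alpha> ^ 2 + c1 * \<alpha> + c0) * \<mu> 0 = 0"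
      using rec_c[of 0] step[of 0] step[of 1] m
      by (simp add: numeral_2_eq_2 algebra_simps power2_eq_square)
    ultimately have "\<mu> 0 = 0" by simp
    with that show ?thesis
      by (induction i) (use step in auto)
  qed
  \<comment> \<open>If \<open>d1 = c1\<close>, the difference says nothing beyond \<open>m\<close>;
    the last two values come from the recurrence of g itself.\<close>
  consider "i \<le> m" | "i = m + 1" | "i = m + 2" using i by linarith
  moreover have m1: "\<mu> (m + 1) = 0"
    using rec_c[of "m - 1"] low[of m] low[of "m - 1"] m by (simp add: numeral_2_eq_2)
  moreover have "\<mu> (m + 2) = 0"
    using rec_c[of m] m1 low[of m] by simp
  ultimately show ?thesis using low by metis
qed

lemma coeff_pCons_cases: "coeff (pCons a p) n = (if n = 0 then a else coeff p (n - 1))"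
  by (simp add: coeff_pCons split: nat.split)

context cubic_extension
begin

text \<open>The last condition says that multiplying three independent polynomials of degree at most 2 by
  \<open>p\<close> gives a curve whose \<open>k + 1\<close> coefficient vectors are independent over the small field.\<close>

definition clears_denominator :: "nat \<Rightarrow> 'b poly \<Rightarrow> 'b poly \<Rightarrow> bool" where
  "clears_denominator k g p \<longleftrightarrow>
     degree p + 2 = k \<and> lead_coeff p = 1 \<and> (\<forall>t. poly p (\<iota> t) \<noteq> 0) \<and>
     (\<forall>j. coeff (g * p) j \<in> range \<iota>) \<and>
     (\<forall>l. (\<forall>i\<le>2. (\<Sum>j\<le>degree p. coeff p j * \<iota> (l (i + j))) = 0) \<longrightarrow> (\<forall>j\<le>k. l j = 0))"

lemmas fr_simps = fr_add fr_mult fr_minus fr_diff fr_fr_fr fr_iota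

lemma clears_denominator_rational:
  assumes "fr c0 = c0" and "fr c1 = c1"
  shows "clears_denominator 2 [:c0, c1, 1:] 1"
  unfolding clears_denominator_def
  by (auto simp: coeff_pCons_cases assms simp flip: fr_fixed_iff)

text \<open>The product \<open>g * p\<close> is the minimal polynomial of \<open>\<alpha>\<close>
  over GF(q). A functional killing X^i p is geometric with ratio \<open>fr \<alpha>\<close> and,
  after conjugation, also with the different ratio \<open>\<alpha>\<close>.\<close>

lemma clears_denominator_conjugate_roots:
  assumes "fr \<alpha> \<noteq> \<alpha>"
  shows "clears_denominator 3 ([:- \<alpha>, 1:] * [:- fr (fr \<alpha>), 1:]) [:- fr \<alpha>, 1:]"
proof -
  let ?p = "[:- fr \<alpha>, 1:]"
  have root: "poly ?p (\<iota> t) \<noteq> 0" for t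
  proof
    assume "poly ?p (\<iota> t) = 0"
    then have "fr \<alpha> = \<iota> t" by simp
    then show False using assms by (metis fr_eq_iff fr_iota)
  qed
  have rat: "coeff ([:- \<alpha>, 1:] * [:- fr (fr \<alpha>), 1:] * ?p) j \<in> range \<iota>" for j
    unfolding fr_fixed_iff[symmetric] by (simp add: coeff_pCons_cases fr_simps algebra_simps)
  have "l j = 0" if kill: "\<And>i. i \<le> 2 \<Longrightarrow> (\<Sum>j\<le>degree ?p. coeff ?p j * \<iota> (l (i + j))) = 0"
    and j: "j \<le> 3" for l :: "nat \<Rightarrow> 'a" and j
  proof -
    have 1: "\<iota> (l (i + 1)) - fr \<alpha> * \<iota> (l i) = 0" if "i \<le> 2" for i
      using kill[OF that] by simp
    have 2: "\<iota> (l (i + 1)) - \<alpha> * \<iota> (l i) = 0" if "i \<le> 2" for i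
      using arg_cong[OF 1[OF that], of "\<lambda>x. fr (fr x)"] by (simp add: fr_simps)
    have low: "l i = 0" if "i \<le> 2" for i
    proof -
      have "(fr \<alpha> - \<alpha>) * \<iota> (l i) = 0"
        using 1[OF that] 2[OF that] by (simp add: algebra_simps)
      then show ?thesis using assms by simp
    qed
    moreover have "l 3 = 0"
      using 1[of 2] low[of 2] by simp
    moreover have "j \<le> 2 \<or> j = 3" using j by linarith
    ultimately show ?thesis by auto
  qed
  then show ?thesis
    unfolding clears_denominator_def using root rat by auto
qed

text \<open>The product \<open>g * p\<close> is X - \<alpha> times the minimal polynomial of
  \<open>\<beta>\<close> over GF(q), so only the two missing conjugates of \<open>\<beta>\<close>
  have to be supplied.\<close>

lemma clears_denominator_one_rational_root:
  assumes \<alpha>: "fr \<alpha> = \<alpha>" and \<beta>: "fr \<beta> \<noteq> \<beta>"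
  shows "clears_denominator 4 ([:- \<alpha>, 1:] * [:- \<beta>, 1:]) ([:- fr \<beta>, 1:] * [:- fr (fr \<beta>), 1:])"
proof -
  let ?p = "[:- fr \<beta>, 1:] * [:- fr (fr \<beta>), 1:]"
  have p: "?p = [:fr \<beta> * fr (fr \<beta>), - (fr \<beta> + fr (fr \<beta>)), 1:]"
    by simp
  have root: "poly ?p (\<iota> t) \<noteq> 0" for t
  proof
    assume "poly ?p (\<iota> t) = 0"
    then have "fr \<beta> = \<iota> t \<or> fr (fr \<beta>) = \<iota> t"
      unfolding poly_mult mult_eq_0_iff by auto
    then show False using \<beta> by (metis fr_eq_iff fr_iota)
  qed
  have rat: "coeff ([:- \<alpha>, 1:] * [:- \<beta>, 1:] * ?p) j \<in> range \<iota>" for j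
    unfolding fr_fixed_iff[symmetric] by (simp add: coeff_pCons_cases fr_simps \<alpha> algebra_simps)
  have "l j = 0" if kill: "\<And>i. i \<le> 2 \<Longrightarrow> (\<Sum>j\<le>degree ?p. coeff ?p j * \<iota> (l (i + j))) = 0"
    and j: "j \<le> 4" for l :: "nat \<Rightarrow> 'a" and j
  proof -
    have 1: "\<iota> (l (i + 2)) - (fr \<beta> + fr (fr \<beta>)) * \<iota> (l (i + 1)) + fr \<beta> * fr (fr \<beta>) * \<iota> (l i) = 0"
      if "i \<le> 2" for i
      using kill[OF that] unfolding p by (simp add: numeral_2_eq_2 algebra_simps)
    have 2: "\<iota> (l (i + 2)) - (\<beta> + fr \<beta>) * \<iota> (l (i + 1)) + \<beta> * fr \<beta> * \<iota> (l i) = 0"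
      if "i \<le> 2" for i
      using arg_cong[OF 1[OF that], of "\<lambda>x. fr (fr x)"] by (simp add: fr_simps)
    \<comment> \<open>The two second-order recurrences share the root \<open>fr \<beta>\<close>;
      their difference is the first-order recurrence of that root, times
      \<open>fr (fr \<beta>) - \<beta>\<close>.\<close>
    have 3: "\<iota> (l (i + 1)) - fr \<beta> * \<iota> (l i) = 0" if "i \<le> 2" for i
    proof -
      have "(fr (fr \<beta>) - \<beta>) * (\<iota> (l (i + 1)) - fr \<beta> * \<iota> (l i)) = 0"
        using 1[OF that] 2[OF that] by algebra
      then show ?thesis using \<beta> by (metis fr_fr_fr mult_eq_0_iff right_minus_eq)
    qed
    have 4: "\<iota> (l (i + 1)) - \<beta> * \<iota> (l i) = 0" if "i \<le> 2" for i
      using arg_cong[OF 3[OF that], of "\<lambda>x. fr (fr x)"] by (simp add: fr_simps)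
    have low: "l i = 0" if "i \<le> 2" for i
    proof -
      have "(fr \<beta> - \<beta>) * \<iota> (l i) = 0"
        using 3[OF that] 4[OF that] by (simp add: algebra_simps)
      then show ?thesis using \<beta> by simp
    qed
    moreover have 5: "l 3 = 0"
      using 3[of 2] low[of 2] by simp
    moreover have "l 4 = 0"
      using 1[of 2] low[of 2] 5 by simp
    moreover have "j \<le> 2 \<or> j = 3 \<or> j = 4" using j by linarith
    ultimately show ?thesis by auto
  qed
  then show ?thesis
    unfolding clears_denominator_def using root rat by (auto simp: p)
qed

text \<open>The product \<open>g * p\<close> is the norm g g' g''. Independence takes two rounds of
  \<open>two_recurrences_imp_zero\<close>: one for the functional f -> l(g'' f), one for l
  itself.\<close>

lemma clears_denominator_coprime:
  assumes ne: "fr c0 \<noteq> c0 \<or> fr c1 \<noteq> c1"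
    and no_root: "\<And>\<alpha>. \<alpha> ^ 2 + c1 * \<alpha> + c0 = 0 \<Longrightarrow> \<alpha> ^ 2 + fr c1 * \<alpha> + fr c0 \<noteq> 0"
  shows "clears_denominator 6 [:c0, c1, 1:] ([:fr c0, fr c1, 1:] * [:fr (fr c0), fr (fr c1), 1:])"
proof -
  let ?p = "[:fr c0, fr c1, 1:] * [:fr (fr c0), fr (fr c1), 1:]"
  have p: "?p = [:fr c0 * fr (fr c0), fr c0 * fr (fr c1) + fr c1 * fr (fr c0),
      fr c0 + fr c1 * fr (fr c1) + fr (fr c0), fr c1 + fr (fr c1), 1:]"
    by simp
  have root: "poly ?p (\<iota> t) \<noteq> 0" for t
  proof
    assume "poly ?p (\<iota> t) = 0"
    then have "\<iota> t ^ 2 + fr c1 * \<iota> t + fr c0 = 0 \<or>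
        \<iota> t ^ 2 + fr (fr c1) * \<iota> t + fr (fr c0) = 0"
      unfolding poly_mult mult_eq_0_iff by (simp add: algebra_simps power2_eq_square)
    moreover have "fr (\<iota> t ^ 2 + fr (fr c1) * \<iota> t + fr (fr c0)) = \<iota> t ^ 2 + c1 * \<iota> t + c0"
      "fr (fr (\<iota> t ^ 2 + fr c1 * \<iota> t + fr c0)) = \<iota> t ^ 2 + c1 * \<iota> t + c0"
      "fr (\<iota> t ^ 2 + c1 * \<iota> t + c0) = \<iota> t ^ 2 + fr c1 * \<iota> t + fr c0"
      by (simp_all add: fr_simps power2_eq_square)
    ultimately have "\<iota> t ^ 2 + c1 * \<iota> t + c0 = 0" "\<iota> t ^ 2 + fr c1 * \<iota> t + fr c0 = 0"
      by (metis fr_zero)+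
    then show False using no_root by blast
  qed
  have rat: "coeff ([:c0, c1, 1:] * ?p) j \<in> range \<iota>" for j
    unfolding fr_fixed_iff[symmetric] by (simp add: coeff_pCons_cases fr_simps algebra_simps)
  have "l j = 0" if kill: "\<And>i. i \<le> 2 \<Longrightarrow> (\<Sum>j\<le>degree ?p. coeff ?p j * \<iota> (l (i + j))) = 0"
    and j: "j \<le> 6" for l :: "nat \<Rightarrow> 'a" and j
  proof -
    define L where "L i = \<iota> (l i)" for i
    have fr_L: "fr (L i) = L i" for i by (simp add: L_def)
    \<comment> \<open>The value of the functional at X^i g''.\<close>
    define \<mu> where "\<mu> i = L (i + 2) + fr (fr c1) * L (i + 1) + fr (fr c0) * L i" for i
    have deg: "degree ?p = 4" unfolding p by simp
    have 1: "\<mu> (i + 2) + fr c1 * \<mu> (i + 1) + fr c0 * \<mu> i = 0" if "i \<le> 2" for i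
      using kill[OF that] unfolding p \<mu>_def L_def
      by (simp add: eval_nat_numeral algebra_simps)
    \<comment> \<open>Conjugation turns g' g'' into g'' g, so the same \<open>\<mu>\<close> also
      obeys the recurrence of g.\<close>
    have 2: "\<mu> (i + 2) + c1 * \<mu> (i + 1) + c0 * \<mu> i = 0" if "i \<le> 2" for i
      using arg_cong[OF 1[OF that], of fr] by (simp add: fr_simps fr_L \<mu>_def algebra_simps)
    have 3: "\<mu> i = 0" if "i \<le> 4" for i
      by (rule two_recurrences_imp_zero[where m = 2, OF _ 2 1 _ no_root]) (use ne that in auto)
    \<comment> \<open>By \<open>3\<close> the functional kills X^i g''; conjugating once and twice
      gives the recurrences of g and g' for the second round.\<close>
    have 4: "L (i + 2) + c1 * L (i + 1) + c0 * L i = 0" if "i \<le> 4" for i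
      using arg_cong[OF 3[OF that], of fr] by (simp add: fr_simps fr_L \<mu>_def)
    have 5: "L (i + 2) + fr c1 * L (i + 1) + fr c0 * L i = 0" if "i \<le> 4" for i
      using arg_cong[OF 4[OF that], of fr] by (simp add: fr_simps fr_L)
    have "L j = 0"
      by (rule two_recurrences_imp_zero[where m = 4, OF _ 4 5 _ no_root]) (use ne j in auto)
    then show ?thesis by (simp add: L_def)
  qed
  then show ?thesis
    unfolding clears_denominator_def using root rat by (auto simp: p)
qed

lemma ex_clears_denominator:
  "\<exists>k\<in>{2, 3, 4, 6}. \<exists>p. clears_denominator k [:c0, c1, 1:] p"
proof (cases "fr c0 = c0 \<and> fr c1 = c1")
  case True
  then show ?thesis using clears_denominator_rational by blast
next
  case irrational: False
  show ?thesis
  proof (cases "\<exists>\<alpha>. \<alpha> ^ 2 + c1 * \<alpha> + c0 = 0 \<and> \<alpha> ^ 2 + fr c1 * \<alpha> + fr c0 = 0")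
    case False
    then show ?thesis using clears_denominator_coprime[of c0 c1] irrational by blast
  next
    case True
    then obtain \<alpha> where \<alpha>: "\<alpha> ^ 2 + c1 * \<alpha> + c0 = 0" "\<alpha> ^ 2 + fr c1 * \<alpha> + fr c0 = 0"
      by blast
    define \<beta> where "\<beta> = - c1 - \<alpha>"
    have c1: "c1 = - (\<alpha> + \<beta>)" by (simp add: \<beta>_def)
    have c0: "c0 = \<alpha> * \<beta>"
      using \<alpha>(1) unfolding \<beta>_def by algebra
    have g: "[:c0, c1, 1:] = [:- \<alpha>, 1:] * [:- \<beta>, 1:]"
      by (simp add: c0 c1)
    \<comment> \<open>The roots of g' are the conjugates of the roots of g, and
      \<open>\<alpha>\<close> is one of them.\<close>
    have "(\<alpha> - fr \<alpha>) * (\<alpha> - fr \<beta>) = 0"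
      using \<alpha>(2) unfolding c0 c1 by (simp add: fr_simps algebra_simps power2_eq_square)
    then consider "fr \<alpha> = \<alpha>" | "fr \<alpha> \<noteq> \<alpha>" "\<alpha> = fr \<beta>"
      unfolding mult_eq_0_iff right_minus_eq by metis
    then show ?thesis
    proof cases
      case 1
      with irrational have "fr \<beta> \<noteq> \<beta>"
        by (auto simp: c0 c1 fr_simps)
      with 1 show ?thesis
        using clears_denominator_one_rational_root g by auto
    next
      case 2
      then have "\<beta> = fr (fr \<alpha>)" by simp
      then have "clears_denominator 3 [:c0, c1, 1:] [:- fr \<alpha>, 1:]"
        unfolding g using clears_denominator_conjugate_roots[OF 2(1)] by (simp only:)
      then show ?thesis by blast
    qed
  qed
qed

end

section \<open>Points and lines of a projective plane\<close>

lemma dim_pair: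
  fixes u v :: "'a::field ^ 'n"
  assumes "u \<noteq> 0" and "v \<notin> vec.span {u}"
  shows "vec.dim {v, u} = 2"
  using assms by (simp add: vec.dim_insert)

lemma mem_pg_points: "P \<in> pg_points \<longleftrightarrow> (\<exists>v. v \<noteq> 0 \<and> P = vec.span {v})"
proof
  assume "P \<in> pg_points"
  then have P: "vec.subspace P" "vec.dim P = 1"
    by (auto simp: pg_points_def pg_spaces_def)
  obtain B where B: "B \<subseteq> P" "vec.independent B" "P \<subseteq> vec.span B" "card B = 1"
    using vec.basis_exists[of P] P(2) by metis
  then obtain v where v: "B = {v}" using card_1_singletonE by blast
  have "v \<noteq> 0" using B(2) v by simp
  moreover have "P = vec.span {v}"
    using B P(1) v vec.span_subspace by blast
  ultimately show "\<exists>v. v \<noteq> 0 \<and> P = vec.span {v}" by blast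
next
  assume "\<exists>v. v \<noteq> 0 \<and> P = vec.span {v}"
  then show "P \<in> pg_points"
    by (auto simp: pg_points_def pg_spaces_def)
qed

lemma span_singleton_in_pg_points [simp]: "v \<noteq> 0 \<Longrightarrow> vec.span {v} \<in> pg_points"
  using mem_pg_points by blast

lemma span_singleton_eq_iff:
  fixes u v :: "'a::field ^ 'n"
  assumes "u \<noteq> 0" and "v \<noteq> 0"
  shows "vec.span {u} = vec.span {v} \<longleftrightarrow> (\<exists>c. c \<noteq> 0 \<and> v = c *s u)"
proof
  assume "vec.span {u} = vec.span {v}"
  then have "v \<in> vec.span {u}" using vec.span_base by blast
  then show "\<exists>c. c \<noteq> 0 \<and> v = c *s u"
    using assms by (auto simp: vec.span_singleton)
next
  assume "\<exists>c. c \<noteq> 0 \<and> v = c *s u"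
  then obtain c where "c \<noteq> 0" "v = c *s u" by blast
  then show "vec.span {u} = vec.span {v}"
    using vec.span_image_scale[of "{u}" "\<lambda>_. c"] by simp
qed

lemma span_scale_singleton:
  fixes v :: "'a::field ^ 'n"
  shows "c \<noteq> 0 \<Longrightarrow> vec.span {c *s v} = vec.span {v}"
  using vec.span_image_scale[of "{v}" "\<lambda>_. c"] by simp

lemma span_singleton_eq_of_mem:
  fixes v :: "'a::field ^ 'n"
  assumes "v \<in> vec.span {u}" and "v \<noteq> 0"
  shows "vec.span {v} = vec.span {u}"
proof -
  obtain c where "v = c *s u" using assms(1) by (auto simp: vec.span_singleton)
  then show ?thesis using assms(2) by (cases "c = 0") (simp_all add: span_scale_singleton)
qed

lemma span_singleton_subset:
  fixes v :: "'a::field ^ 'n"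
  shows "v \<in> vec.span S \<Longrightarrow> vec.span {v} \<subseteq> vec.span S"
  by (rule vec.span_minimal) auto

lemma scale_mem_span_singleton: "(c *s v :: 'a::field ^ 'n) \<in> vec.span {v}"
  by (intro vec.span_scale vec.span_base) simp

lemma pg_line_through:
  fixes u v :: "'a::field ^ 'n"
  assumes "u \<noteq> 0" and "v \<notin> vec.span {u}"
  shows "{P \<in> pg_points. P \<subseteq> vec.span {u, v}} \<in> pg_lines"
    and "vec.span {u} \<in> {P \<in> pg_points. P \<subseteq> vec.span {u, v}}"
    and "vec.span {v} \<in> {P \<in> pg_points. P \<subseteq> vec.span {u, v}}"
proof -
  have "vec.span {u, v} \<in> pg_spaces 1"
    using dim_pair[OF assms] by (simp add: pg_spaces_def insert_commute)
  then show "{P \<in> pg_points. P \<subseteq> vec.span {u, v}} \<in> pg_lines"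
    by (auto simp: pg_lines_def)
  have "v \<noteq> 0" using assms(2) vec.span_zero by metis
  then show "vec.span {u} \<in> {P \<in> pg_points. P \<subseteq> vec.span {u, v}}"
    "vec.span {v} \<in> {P \<in> pg_points. P \<subseteq> vec.span {u, v}}"
    using assms(1) by (auto intro: vec.span_mono[THEN subsetD])
qed

lemma span_pair_eq_of_dim_2:
  fixes u v :: "'a::field ^ 'n"
  assumes "L \<in> pg_spaces 1" and "u \<in> L" and "v \<in> L" and "u \<noteq> 0" and "v \<notin> vec.span {u}"
  shows "vec.span {u, v} = L"
proof (rule vec.subspace_dim_equal)
  show "vec.span {u, v} \<subseteq> L"
    using assms by (intro vec.span_minimal) (auto simp: pg_spaces_def)
  show "vec.dim L \<le> vec.dim (vec.span {u, v})"
    using assms dim_pair[OF assms(4,5)] by (simp add: pg_spaces_def insert_commute)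
qed (use assms in \<open>auto simp: pg_spaces_def\<close>)

lemma mem_pg_line_imp_span_pair:
  fixes u v w :: "'a::field ^ 'n"
  assumes "l \<in> pg_lines" and "vec.span {u} \<in> l" and "vec.span {v} \<in> l" and "vec.span {w} \<in> l"
    and "u \<noteq> 0" and "v \<notin> vec.span {u}"
  shows "w \<in> vec.span {u, v}"
proof -
  obtain L where L: "L \<in> pg_spaces 1" and l: "l = {P \<in> pg_points. P \<subseteq> L}"
    using assms(1) by (auto simp: pg_lines_def)
  have "u \<in> L" "v \<in> L" "w \<in> L"
    using assms(2-4) l vec.span_base by blast+
  then show ?thesis
    using span_pair_eq_of_dim_2[OF L _ _ assms(5,6)] by blast
qed

lemma mem_span_pair:
  fixes u v w :: "'a::field ^ 'n"
  shows "w \<in> vec.span {u, v} \<longleftrightarrow> (\<exists>a b. w = a *s u + b *s v)"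
proof
  assume "w \<in> vec.span {u, v}"
  then obtain a where "w - a *s u \<in> vec.span {v}"
    using vec.span_breakdown_eq by blast
  then obtain b where "w - a *s u = b *s v"
    by (auto simp: vec.span_singleton)
  then have "w = a *s u + b *s v" by (simp add: diff_eq_eq add.commute)
  then show "\<exists>a b. w = a *s u + b *s v" by blast
next
  assume "\<exists>a b. w = a *s u + b *s v"
  then show "w \<in> vec.span {u, v}"
    by (auto simp: insertI1 intro!: vec.span_add vec.span_scale intro: vec.span_base)
qed

lemma mem_span_triple:
  fixes u v w :: "'a::field ^ 'n"
  shows "x \<in> vec.span {u, v, w} \<longleftrightarrow> (\<exists>a b c. x = a *s u + b *s v + c *s w)"
proof
  assume "x \<in> vec.span {u, v, w}"
  then obtain a where "x - a *s u \<in> vec.span {v, w}"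
    using vec.span_breakdown_eq by blast
  then obtain b c where "x - a *s u = b *s v + c *s w"
    unfolding mem_span_pair by blast
  then have "x = a *s u + b *s v + c *s w" by (simp add: diff_eq_eq ac_simps)
  then show "\<exists>a b c. x = a *s u + b *s v + c *s w" by blast
next
  assume "\<exists>a b c. x = a *s u + b *s v + c *s w"
  then show "x \<in> vec.span {u, v, w}"
    by (auto simp: insertI1 intro!: vec.span_add vec.span_scale intro: vec.span_base)
qed

text \<open>Stated by coefficients, since independence of the set {u, v, w} would not notice
  repeated vectors.\<close>

definition indep3 :: "'a::field ^ 3 \<Rightarrow> 'a ^ 3 \<Rightarrow> 'a ^ 3 \<Rightarrow> bool" where
  "indep3 u v w \<longleftrightarrow> (\<forall>a b c. a *s u + b *s v + c *s w = 0 \<longrightarrow> a = 0 \<and> b = 0 \<and> c = 0)"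

lemma indep3_cancel:
  assumes "indep3 u v w" and "a *s u + b *s v + c *s w = a' *s u + b' *s v + c' *s w"
  shows "a = a' \<and> b = b' \<and> c = c'"
proof -
  have "(a - a') *s u + (b - b') *s v + (c - c') *s w = 0"
    using assms(2) by (simp add: vec.scale_left_diff_distrib algebra_simps)
  then show ?thesis using assms(1) unfolding indep3_def by (metis right_minus_eq)
qed

lemma indep3_iff_not_in_span:
  "indep3 u v w \<longleftrightarrow> u \<noteq> 0 \<and> v \<notin> vec.span {u} \<and> w \<notin> vec.span {u, v}"
proof
  assume i: "indep3 u v w"
  then have "u \<noteq> 0"
    using i[unfolded indep3_def, rule_format, of 1 0 0] by auto
  moreover have "v \<notin> vec.span {u}"
    using i[unfolded indep3_def, rule_format, of _ "-1" 0] by (auto simp: vec.span_singleton)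
  moreover have "w \<notin> vec.span {u, v}"
    using i[unfolded indep3_def, rule_format, of _ _ "-1"] by (auto simp: mem_span_pair)
  ultimately show "u \<noteq> 0 \<and> v \<notin> vec.span {u} \<and> w \<notin> vec.span {u, v}" by blast
next
  assume *: "u \<noteq> 0 \<and> v \<notin> vec.span {u} \<and> w \<notin> vec.span {u, v}"
  show "indep3 u v w"
    unfolding indep3_def
  proof (intro allI impI)
    fix a b c assume eq: "a *s u + b *s v + c *s w = 0"
    have c: "c = 0"
    proof (rule ccontr)
      assume "c \<noteq> 0"
      have "c *s w = (- a) *s u + (- b) *s v"
        using eq by (simp add: add_eq_0_iff)
      then have "w = inverse c *s ((- a) *s u + (- b) *s v)"
        using \<open>c \<noteq> 0\<close> by (metis vec.scale_one vec.scale_scale left_inverse)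
      then have "w = (inverse c * - a) *s u + (inverse c * - b) *s v"
        by (simp add: vec.scale_right_distrib)
      then show False using * mem_span_pair by blast
    qed
    have b: "b = 0"
    proof (rule ccontr)
      assume "b \<noteq> 0"
      have "b *s v = (- a) *s u"
        using eq c by (simp add: algebra_simps add_eq_0_iff2)
      then have "v = inverse b *s ((- a) *s u)"
        using \<open>b \<noteq> 0\<close> by (metis vec.scale_one vec.scale_scale left_inverse)
      then have "v \<in> vec.span {u}"
        by (metis insertI1 vec.span_base vec.span_scale)
      then show False using * by blast
    qed
    show "a = 0 \<and> b = 0 \<and> c = 0" using eq b c * by simp
  qed
qed

lemma indep3_span:
  assumes "indep3 u v w"
  shows "vec.span {u, v, w} = UNIV"
proof -
  have *: "u \<noteq> 0" "v \<notin> vec.span {u}" "w \<notin> vec.span {u, v}"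
    using assms indep3_iff_not_in_span by blast+
  have eqs: "{u, v, w} = insert w {u, v}" "{v, u} = {u, v}" by auto
  have "vec.dim (insert w {u, v}) = 3"
    using *(3) dim_pair[OF *(1,2)] by (simp add: vec.dim_insert[of w] eqs(2))
  then have "vec.dim (vec.span {u, v, w}) = vec.dim (UNIV :: ('a ^ 3) set)"
    unfolding vec.dim_span eqs(1) vec_dim_card by simp
  then show ?thesis
    by (intro vec.subspace_dim_equal) auto
qed

lemma indep3_if_span:
  assumes "vec.span {u, v, w} = (UNIV :: ('a::field ^ 3) set)"
  shows "indep3 u v w"
proof -
  have eqs: "{u, v, w} = insert w {u, v}" "{u, v} = insert v {u}" by auto
  have d: "vec.dim (insert w {u, v}) = 3"
    using arg_cong[OF assms, of vec.dim] unfolding vec.dim_span eqs(1) vec_dim_card by simp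
  have le: "vec.dim {u, v} \<le> card {u, v}" "vec.dim {u} \<le> card {u}"
    by (rule vec.dim_le_card'; simp)+
  have "card {u, v} \<le> 2" by (simp add: card_insert_if)
  then have w: "w \<notin> vec.span {u, v}" and "vec.dim {u, v} = 2"
    using d le by (auto simp: vec.dim_insert[of w] split: if_splits)
  then have "v \<notin> vec.span {u}" "u \<noteq> 0"
    unfolding eqs(2) vec.dim_insert[of v] by (auto split: if_splits)
  then show ?thesis using w indep3_iff_not_in_span by blast
qed

section \<open>The fundamental theorem for embedded planes\<close>

lemma vec3_eq_iff: "(x :: 'a ^ 3) = y \<longleftrightarrow> x $ 1 = y $ 1 \<and> x $ 2 = y $ 2 \<and> x $ 3 = y $ 3"
  by (simp add: vec_eq_iff forall_3)

lemma vector_3_simps: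
  "vector [a, b, c] + vector [a', b', c'] = (vector [a + a', b + b', c + c'] :: 'a::field ^ 3)"
  "k *s vector [a, b, c] = (vector [k * a, k * b, k * c] :: 'a::field ^ 3)"
  "vector [a, b, c] = (0 :: 'a::field ^ 3) \<longleftrightarrow> a = 0 \<and> b = 0 \<and> c = 0"
  "vector [a, b, c] = (vector [a', b', c'] :: 'a::field ^ 3) \<longleftrightarrow> a = a' \<and> b = b' \<and> c = c'"
  by (auto simp: vec3_eq_iff vector_3)

text \<open>Neither surjectivity nor images that fill whole lines are assumed, as a subplane
  requires. Preservation of collinearity does not by itself prevent the image from collapsing into
  one line; \<open>reflects\<close> does.\<close>

locale plane_embedding =
  fixes \<Psi> :: "('a::field ^ 3) set \<Rightarrow> ('b::field ^ 3) set"
  assumes inj: "inj_on \<Psi> pg_points"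
    and maps: "\<Psi> ` pg_points \<subseteq> pg_points"
    and lines: "\<And>l. l \<in> pg_lines \<Longrightarrow> \<exists>l'\<in>pg_lines. \<Psi> ` l \<subseteq> l'"
    and reflects: "\<And>x y z l'. \<lbrakk>x \<in> pg_points; y \<in> pg_points; z \<in> pg_points; x \<noteq> y;
        l' \<in> pg_lines; \<Psi> x \<in> l'; \<Psi> y \<in> l'; \<Psi> z \<in> l'\<rbrakk> \<Longrightarrow> \<exists>l\<in>pg_lines. x \<in> l \<and> y \<in> l \<and> z \<in> l"
begin

text \<open>A relation rather than a function: the homogeneous coordinates of an image point are
  fixed only up to a nonzero scalar, and the proofs choose the representative that suits
  them.\<close>

definition img :: "'a ^ 3 \<Rightarrow> 'b ^ 3 \<Rightarrow> bool" where
  "img x y \<longleftrightarrow> x \<noteq> 0 \<and> y \<noteq> 0 \<and> \<Psi> (vec.span {x}) = vec.span {y}"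

lemma img_nonzero: "img x y \<Longrightarrow> x \<noteq> 0 \<and> y \<noteq> 0"
  by (simp add: img_def)

lemma ex_img: "x \<noteq> 0 \<Longrightarrow> \<exists>y. img x y"
  using maps mem_pg_points[of "\<Psi> (vec.span {x})"] by (force simp: img_def)

lemma img_scale_right: "img x y \<Longrightarrow> k \<noteq> 0 \<Longrightarrow> img x (k *s y)"
  by (simp add: img_def span_scale_singleton)

lemma img_scale_left: "img x y \<Longrightarrow> c \<noteq> 0 \<Longrightarrow> img (c *s x) y"
  by (simp add: img_def span_scale_singleton)

lemma img_unique: "img x y \<Longrightarrow> img x y' \<Longrightarrow> \<exists>k. k \<noteq> 0 \<and> y' = k *s y"
  by (metis img_def span_singleton_eq_iff)

lemma img_in_span_imp:
  assumes "img x y" and "img x' y'" and "y' \<in> vec.span {y}"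
  shows "x' \<in> vec.span {x}"
proof -
  have "vec.span {y'} = vec.span {y}"
    using assms img_nonzero by (intro span_singleton_eq_of_mem) auto
  then have "vec.span {x'} = vec.span {x}"
    using assms(1,2) inj unfolding img_def by (metis inj_onD span_singleton_in_pg_points)
  then show ?thesis using vec.span_base by blast
qed

lemma img_span_pair:
  assumes "img u u'" and "img v v'" and "img w w'" and "w \<in> vec.span {u, v}"
  shows "w' \<in> vec.span {u', v'}"
proof (cases "v \<in> vec.span {u}")
  case True
  then have "vec.span {u, v} = vec.span {u}"
    using vec.span_redundant[OF True] by (simp add: insert_commute)
  then have "w \<in> vec.span {u}" using assms(4) by simp
  then have "vec.span {w} = vec.span {u}"
    using assms(3) img_nonzero by (intro span_singleton_eq_of_mem) auto
  then have "w' \<in> vec.span {u'}"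
    using assms(1,3) unfolding img_def by (metis insertI1 vec.span_base)
  then show ?thesis using vec.span_mono[of "{u'}" "{u', v'}"] by blast
next
  case False
  have u: "u \<noteq> 0" and w: "w \<noteq> 0" using assms img_nonzero by auto
  define l where "l = {P \<in> pg_points. P \<subseteq> vec.span {u, v}}"
  note * = pg_line_through[OF u False, folded l_def]
  have "vec.span {w} \<in> l"
    using assms(4) w by (simp add: l_def span_singleton_subset)
  moreover obtain l' where l': "l' \<in> pg_lines" "\<Psi> ` l \<subseteq> l'" using lines * by blast
  ultimately have "vec.span {u'} \<in> l'" "vec.span {v'} \<in> l'" "vec.span {w'} \<in> l'"
    using assms * by (auto simp: img_def)
  moreover have "v' \<notin> vec.span {u'}" using img_in_span_imp assms False by blast
  ultimately show ?thesis
    using mem_pg_line_imp_span_pair[OF l'(1)] assms(1) img_nonzero by blast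
qed

lemma img_span_pair_reflects:
  assumes "img u u'" and "img v v'" and "img w w'" and "w' \<in> vec.span {u', v'}"
    and nv: "v \<notin> vec.span {u}"
  shows "w \<in> vec.span {u, v}"
proof -
  have nz: "u \<noteq> 0" "v \<noteq> 0" "w \<noteq> 0" "u' \<noteq> 0" "w' \<noteq> 0" using assms img_nonzero by auto
  have n: "v' \<notin> vec.span {u'}" using img_in_span_imp assms by blast
  define l' where "l' = {P \<in> pg_points. P \<subseteq> vec.span {u', v'}}"
  note * = pg_line_through[OF nz(4) n, folded l'_def]
  have "vec.span {w'} \<in> l'"
    using assms(4) nz by (simp add: l'_def span_singleton_subset)
  moreover have "vec.span {u} \<noteq> vec.span {v}"
    using nv vec.span_base by blast
  ultimately obtain l where "l \<in> pg_lines" "vec.span {u} \<in> l" "vec.span {v} \<in> l" "vec.span {w} \<in> l"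
    using reflects[of "vec.span {u}" "vec.span {v}" "vec.span {w}" l'] * nz assms(1-3)
    by (auto simp: img_def)
  then show ?thesis using mem_pg_line_imp_span_pair nz nv by blast
qed

lemma img_comb:
  assumes "img u u'" and "img v v'" and "w = a *s u + b *s v" and "w \<noteq> 0"
  shows "\<exists>c d. img w (c *s u' + d *s v')"
proof -
  obtain w' where w': "img w w'" using assms ex_img by blast
  then have "w' \<in> vec.span {u', v'}"
    using img_span_pair assms mem_span_pair by blast
  then show ?thesis using w' mem_span_pair by metis
qed

text \<open>The unit point is on no side of the coordinate triangle. By reflection its image is on
  no side of the image triangle, so its three coordinates are nonzero and can be absorbed into the
  basis.\<close>

lemma ex_frame:
  "\<exists>b1 b2 b3. indep3 b1 b2 b3 \<and> img (vector [1, 0, 0]) b1 \<and> img (vector [0, 1, 0]) b2 \<and>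
     img (vector [0, 0, 1]) b3 \<and> img (vector [1, 1, 1]) (b1 + b2 + b3)"
proof -
  let ?e1 = "vector [1, 0, 0] :: 'a ^ 3" and ?e2 = "vector [0, 1, 0] :: 'a ^ 3"
    and ?e3 = "vector [0, 0, 1] :: 'a ^ 3" and ?e0 = "vector [1, 1, 1] :: 'a ^ 3"
  obtain m1 m2 m3 m0 where m: "img ?e1 m1" "img ?e2 m2" "img ?e3 m3" "img ?e0 m0"
    using ex_img by (metis vector_3_simps(3) zero_neq_one)
  have e12: "?e2 \<notin> vec.span {?e1}" and e13: "?e3 \<notin> vec.span {?e1}"
    and e23: "?e3 \<notin> vec.span {?e2}"
    by (auto simp: vec.span_singleton vector_3_simps)
  have "?e3 \<notin> vec.span {?e1, ?e2}" and e0: "?e0 \<notin> vec.span {?e1, ?e2}"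
    "?e0 \<notin> vec.span {?e1, ?e3}" "?e0 \<notin> vec.span {?e2, ?e3}"
    by (auto simp: mem_span_pair vector_3_simps)
  then have i: "indep3 m1 m2 m3"
    unfolding indep3_iff_not_in_span
    using img_span_pair_reflects m e12 img_in_span_imp img_nonzero by metis
  then obtain a b c where abc: "m0 = a *s m1 + b *s m2 + c *s m3"
    using indep3_span mem_span_triple by (metis UNIV_I)
  have "a \<noteq> 0"
  proof
    assume "a = 0"
    then have "m0 \<in> vec.span {m2, m3}" using abc mem_span_pair[of m0 m2 m3] by auto
    then show False using img_span_pair_reflects m e0 e23 by blast
  qed
  moreover have "b \<noteq> 0"
  proof
    assume "b = 0"
    then have "m0 \<in> vec.span {m1, m3}" using abc mem_span_pair[of m0 m1 m3] by auto
    then show False using img_span_pair_reflects m e0 e13 by blast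
  qed
  moreover have "c \<noteq> 0"
  proof
    assume "c = 0"
    then have "m0 \<in> vec.span {m1, m2}" using abc mem_span_pair[of m0 m1 m2] by auto
    then show False using img_span_pair_reflects m e0 e12 by blast
  qed
  ultimately have "indep3 (a *s m1) (b *s m2) (c *s m3)"
    using i unfolding indep3_def by (metis mult_eq_0_iff vec.scale_scale)
  then show ?thesis
    using m img_scale_right \<open>a \<noteq> 0\<close> \<open>b \<noteq> 0\<close> \<open>c \<noteq> 0\<close> unfolding abc by blast
qed

end

section \<open>Coordinates relative to the image of the standard frame\<close>

locale framed_plane_embedding = plane_embedding +
  fixes b1 b2 b3 :: "'b::field ^ 3"
  assumes indep: "indep3 b1 b2 b3"
    and img_b1: "img (vector [1, 0, 0]) b1"
    and img_b2: "img (vector [0, 1, 0]) b2"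
    and img_b3: "img (vector [0, 0, 1]) b3"
    and img_b0: "img (vector [1, 1, 1]) (b1 + b2 + b3)"
begin

definition V :: "'b \<Rightarrow> 'b \<Rightarrow> 'b \<Rightarrow> 'b ^ 3" where
  "V x y z = x *s b1 + y *s b2 + z *s b3"

lemma V_add: "V x y z + V x' y' z' = V (x + x') (y + y') (z + z')"
  by (simp add: V_def vec.scale_left_distrib ac_simps)

lemma V_scale: "k *s V x y z = V (k * x) (k * y) (k * z)"
  by (simp add: V_def vec.scale_right_distrib)

lemma V_eq_iff: "V x y z = V x' y' z' \<longleftrightarrow> x = x' \<and> y = y' \<and> z = z'"
  using indep3_cancel[OF indep] unfolding V_def by blast

lemma V_eq_0_iff: "V x y z = 0 \<longleftrightarrow> x = 0 \<and> y = 0 \<and> z = 0"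
  using V_eq_iff[of x y z 0 0 0] by (simp add: V_def)

lemma img_e1: "img (vector [1, 0, 0]) (V 1 0 0)" and img_e2: "img (vector [0, 1, 0]) (V 0 1 0)"
  and img_e3: "img (vector [0, 0, 1]) (V 0 0 1)" and img_e0: "img (vector [1, 1, 1]) (V 1 1 1)"
  using img_b1 img_b2 img_b3 img_b0 by (simp_all add: V_def)

lemma img_V_unique:
  assumes "img w (V x y z)" and "img w (V x' y' z')"
  shows "\<exists>k. k \<noteq> 0 \<and> x' = k * x \<and> y' = k * y \<and> z' = k * z"
  using img_unique[OF assms] by (auto simp: V_scale V_eq_iff)

lemma img_V_comb:
  assumes "img u (V x y z)" and "img v (V x' y' z')" and "w = a *s u + b *s v" and "w \<noteq> 0"
  shows "\<exists>c d. img w (V (c * x + d * x') (c * y + d * y') (c * z + d * z'))"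
  using img_comb[OF assms] by (simp add: V_scale V_add)

lemma img_V_normalize:
  assumes "img w (V (k * x) (k * y) (k * z))"
  shows "img w (V x y z)"
proof -
  have "k \<noteq> 0" using img_nonzero[OF assms] by (auto simp: V_eq_0_iff)
  then show ?thesis
    using img_scale_right[OF assms, of "inverse k"] by (simp add: V_scale field_simps)
qed

text \<open>A zero first coordinate would make the image coincide with that of e2 or e3, contrary to
  injectivity.\<close>

lemma ex_axis_coord:
  "\<exists>s. img (vector [1, a, 0]) (V 1 s 0)"
  "\<exists>s. img (vector [1, 0, a]) (V 1 0 s)"
proof -
  have not_in: "vector [1, a, 0] \<notin> vec.span {vector [0, 1, 0] :: 'a ^ 3}"
    "vector [1, 0, a] \<notin> vec.span {vector [0, 0, 1] :: 'a ^ 3}"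
    by (auto simp: vec.span_singleton vector_3_simps)
  obtain c d where cd: "img (vector [1, a, 0]) (V c d 0)"
    using img_V_comb[OF img_e1 img_e2, of "vector [1, a, 0]" 1 a]
    by (auto simp: vector_3_simps)
  have "c \<noteq> 0"
  proof
    assume "c = 0"
    then have "V c d 0 \<in> vec.span {V 0 1 0}"
      using scale_mem_span_singleton[of d "V 0 1 0"] by (simp add: V_scale)
    then show False using img_in_span_imp[OF img_e2 cd] not_in by blast
  qed
  then have "img (vector [1, a, 0]) (V 1 (d / c) 0)"
    using cd \<open>c \<noteq> 0\<close> by - (rule img_V_normalize[where k = c], simp)
  then show "\<exists>s. img (vector [1, a, 0]) (V 1 s 0)" by blast
  obtain c d where cd: "img (vector [1, 0, a]) (V c 0 d)"
    using img_V_comb[OF img_e1 img_e3, of "vector [1, 0, a]" 1 a]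
    by (auto simp: vector_3_simps)
  have "c \<noteq> 0"
  proof
    assume "c = 0"
    then have "V c 0 d \<in> vec.span {V 0 0 1}"
      using scale_mem_span_singleton[of d "V 0 0 1"] by (simp add: V_scale)
    then show False using img_in_span_imp[OF img_e3 cd] not_in by blast
  qed
  then have "img (vector [1, 0, a]) (V 1 0 (d / c))"
    using cd \<open>c \<noteq> 0\<close> by - (rule img_V_normalize[where k = c], simp)
  then show "\<exists>s. img (vector [1, 0, a]) (V 1 0 s)" by blast
qed

text \<open>The affine coordinate maps on the two axes through e1, with the first coordinate as
  homogenising one. They are separate functions until \<open>tau_eq_sigma\<close>.\<close>

definition \<sigma> :: "'a \<Rightarrow> 'b" where "\<sigma> a = (SOME s. img (vector [1, a, 0]) (V 1 s 0))"
definition \<tau> :: "'a \<Rightarrow> 'b" where "\<tau> a = (SOME s. img (vector [1, 0, a]) (V 1 0 s))"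

lemma img_sigma: "img (vector [1, a, 0]) (V 1 (\<sigma> a) 0)"
  unfolding \<sigma>_def using ex_axis_coord(1) by (rule someI_ex)

lemma img_tau: "img (vector [1, 0, a]) (V 1 0 (\<tau> a))"
  unfolding \<tau>_def using ex_axis_coord(2) by (rule someI_ex)

text \<open>The point (1, a, c) is the intersection of the line joining (1, a, 0) to e3 with the
  line joining (1, 0, c) to e2; each line fixes one ratio of coordinates of the image.\<close>

lemma img_affine: "img (vector [1, a, c]) (V 1 (\<sigma> a) (\<tau> c))"
proof -
  obtain x y where 1: "img (vector [1, a, c]) (V x (x * \<sigma> a) y)"
    using img_V_comb[OF img_sigma[of a] img_e3, of "vector [1, a, c]" 1 c]
    by (auto simp: vector_3_simps)
  obtain x' y' where 2: "img (vector [1, a, c]) (V x' y' (x' * \<tau> c))"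
    using img_V_comb[OF img_tau[of c] img_e2, of "vector [1, a, c]" 1 a]
    by (auto simp: vector_3_simps)
  obtain k where k: "k \<noteq> 0" "x' = k * x" "x' * \<tau> c = k * y"
    using img_V_unique[OF 1 2] by blast
  then have "y = x * \<tau> c" by auto
  then show ?thesis using 1 by - (rule img_V_normalize[where k = x], simp)
qed

lemma sigma_0 [simp]: "\<sigma> 0 = 0" and tau_0 [simp]: "\<tau> 0 = 0"
  and sigma_1 [simp]: "\<sigma> 1 = 1" and tau_1 [simp]: "\<tau> 1 = 1"
  using img_V_unique[OF img_e1 img_affine[of 0 0]] img_V_unique[OF img_e0 img_affine[of 1 1]]
  by auto

text \<open>The point (0, 1, a) is the intersection of the line e2 e3 with the line through e1 and
  (1, 1, a).\<close>

lemma img_at_infinity_tau: "img (vector [0, 1, a]) (V 0 1 (\<tau> a))"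
proof -
  obtain x y where 1: "img (vector [0, 1, a]) (V 0 x y)"
    using img_V_comb[OF img_e2 img_e3, of "vector [0, 1, a]" 1 a]
    by (auto simp: vector_3_simps)
  obtain x' y' where 2: "img (vector [0, 1, a]) (V (x' + y') y' (y' * \<tau> a))"
    using img_V_comb[OF img_e1 img_affine[of 1 a], of "vector [0, 1, a]" "- 1" 1]
    by (auto simp: vector_3_simps)
  obtain k where k: "k \<noteq> 0" "x' + y' = 0" "y' = k * x" "y' * \<tau> a = k * y"
    using img_V_unique[OF 1 2] by auto
  then show ?thesis using 2 by - (rule img_V_normalize[where k = y'], simp)
qed

text \<open>The point (1, c, ca) lies on the line of slope a through the origin e1, which meets the
  line at infinity in (0, 1, a). Taking a = 1 identifies \<open>\<tau>\<close> with
  \<open>\<sigma>\<close>.\<close>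

lemma tau_mult_sigma: "\<tau> (c * a) = \<sigma> c * \<tau> a"
proof -
  obtain x y where 1: "img (vector [1, c, c * a]) (V x y (y * \<tau> a))"
    using img_V_comb[OF img_e1 img_at_infinity_tau[of a], of "vector [1, c, c * a]" 1 c]
    by (auto simp: vector_3_simps)
  show ?thesis
    using img_V_unique[OF img_affine[of c "c * a"] 1] by auto
qed

lemma tau_eq_sigma: "\<tau> = \<sigma>"
  using tau_mult_sigma[of _ 1] by auto

lemma sigma_mult: "\<sigma> (a * c) = \<sigma> a * \<sigma> c"
  using tau_mult_sigma by (simp add: tau_eq_sigma)

lemma img_at_infinity: "img (vector [0, 1, a]) (V 0 1 (\<sigma> a))"
  using img_at_infinity_tau by (simp add: tau_eq_sigma)

lemma img_at_infinity': "img (vector [0, c, 1]) (V 0 (\<sigma> c) 1)"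
proof (cases "c = 0")
  case True
  then show ?thesis using img_e3 by simp
next
  case False
  have "\<sigma> c * \<sigma> (1 / c) = 1"
    using False sigma_mult[of c "1 / c"] by simp
  moreover from this have "\<sigma> c \<noteq> 0" by auto
  ultimately show ?thesis
    using False img_scale_right[OF img_scale_left[OF img_at_infinity[of "1 / c"], of c], of "\<sigma> c"]
    by (auto simp: vector_3_simps V_scale)
qed

text \<open>The point (1, a + c, 1) lies on the line joining (1, a, 0) to (0, c, 1), whose images
  are known.\<close>

lemma sigma_add: "\<sigma> (a + c) = \<sigma> a + \<sigma> c"
proof -
  obtain x y where 1: "img (vector [1, a + c, 1]) (V x (x * \<sigma> a + y * \<sigma> c) y)"
    using img_V_comb[OF img_sigma[of a] img_at_infinity'[of c], of "vector [1, a + c, 1]" 1 1]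
    by (auto simp: vector_3_simps)
  show ?thesis
    using img_V_unique[OF img_affine[of "a + c" 1] 1] by (auto simp flip: distrib_left)
qed

lemma sigma_nonzero: "a \<noteq> 0 \<Longrightarrow> \<sigma> a \<noteq> 0"
  using sigma_mult[of a "1 / a"] by auto

lemma img_V_sigma:
  assumes "vector [x, y, z] \<noteq> (0 :: 'a ^ 3)"
  shows "img (vector [x, y, z]) (V (\<sigma> x) (\<sigma> y) (\<sigma> z))"
proof -
  consider "x \<noteq> 0" | "x = 0" "y \<noteq> 0" | "x = 0" "y = 0" "z \<noteq> 0"
    using assms by (auto simp: vector_3_simps)
  then show ?thesis
  proof cases
    case 1
    then have "img (x *s vector [1, y / x, z / x]) (\<sigma> x *s V 1 (\<sigma> (y / x)) (\<sigma> (z / x)))"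
      using img_affine[of "y / x" "z / x"]
      by (intro img_scale_left img_scale_right) (auto simp: tau_eq_sigma sigma_nonzero)
    then show ?thesis
      using 1 by (simp add: vector_3_simps V_scale flip: sigma_mult)
  next
    case 2
    then have "img (y *s vector [0, 1, z / y]) (\<sigma> y *s V 0 1 (\<sigma> (z / y)))"
      using img_at_infinity[of "z / y"]
      by (intro img_scale_left img_scale_right) (auto simp: sigma_nonzero)
    then show ?thesis
      using 2 by (simp add: vector_3_simps V_scale flip: sigma_mult)
  next
    case 3
    then have "img (z *s vector [0, 0, 1]) (\<sigma> z *s V 0 0 1)"
      using img_e3 by (intro img_scale_left img_scale_right) (auto simp: sigma_nonzero)
    then show ?thesis
      using 3 by (simp add: vector_3_simps V_scale)
  qed
qed

end

text \<open>The fundamental theorem of projective geometry for embeddings: \<open>\<sigma>\<close>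
  is a field embedding that need not be onto, and \<open>M\<close> is semilinear over it.\<close>

theorem (in plane_embedding) semilinear:
  "\<exists>(\<sigma> :: 'a \<Rightarrow> 'b) M. field_embedding \<sigma> \<and>
     (\<forall>x y. M (x + y) = M x + M y) \<and> (\<forall>c x. M (c *s x) = \<sigma> c *s M x) \<and>
     (\<forall>u v w. indep3 u v w \<longrightarrow> indep3 (M u) (M v) (M w)) \<and>
     (\<forall>x. x \<noteq> 0 \<longrightarrow> \<Psi> (vec.span {x}) = vec.span {M x})"
proof -
  obtain b1 b2 b3 where "indep3 b1 b2 b3" "img (vector [1, 0, 0]) b1"
    "img (vector [0, 1, 0]) b2" "img (vector [0, 0, 1]) b3" "img (vector [1, 1, 1]) (b1 + b2 + b3)"
    using ex_frame by blast
  then interpret framed_plane_embedding \<Psi> b1 b2 b3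
    by unfold_locales
  define M where "M x = V (\<sigma> (x $ 1)) (\<sigma> (x $ 2)) (\<sigma> (x $ 3))" for x :: "'a ^ 3"
  have "field_embedding \<sigma>"
    by (simp add: field_embedding_def sigma_add sigma_mult)
  moreover have add: "M (x + y) = M x + M y" for x y
    by (simp add: M_def V_add sigma_add)
  moreover have scale: "M (c *s x) = \<sigma> c *s M x" for c x
    by (simp add: M_def V_scale sigma_mult)
  moreover have "\<Psi> (vec.span {x}) = vec.span {M x}" if "x \<noteq> 0" for x
  proof -
    have x: "vector [x $ 1, x $ 2, x $ 3] = x"
      by (simp add: vec3_eq_iff)
    then show ?thesis
      using img_V_sigma[of "x $ 1" "x $ 2" "x $ 3"] that by (simp add: img_def M_def)
  qed
  moreover have "indep3 (M u) (M v) (M w)" if "indep3 u v w" for u v w :: "'a ^ 3"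
  proof (rule indep3_if_span)
    let ?S = "vec.span {M u, M v, M w}"
    have in_S: "M x \<in> ?S" for x :: "'a ^ 3"
    proof -
      obtain a b c where "x = a *s u + b *s v + c *s w"
        using indep3_span[OF \<open>indep3 u v w\<close>] mem_span_triple by (metis UNIV_I)
      then show ?thesis
        using mem_span_triple[of "M x" "M u" "M v" "M w"] by (auto simp: add scale)
    qed
    \<comment> \<open>\<open>\<sigma>\<close> need not be onto, so a relation between the images
      cannot be pulled back; instead their span over the large field contains the whole
      frame.\<close>
    have "b1 \<in> ?S" "b2 \<in> ?S" "b3 \<in> ?S"
      using in_S[of "vector [1, 0, 0]"] in_S[of "vector [0, 1, 0]"] in_S[of "vector [0, 0, 1]"]
      by (simp_all add: M_def V_def)
    then have "vec.span {b1, b2, b3} \<subseteq> ?S"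
      by (intro vec.span_minimal) auto
    then show "?S = UNIV" using indep3_span[OF indep] by blast
  qed
  ultimately show ?thesis by blast
qed

section \<open>Conics\<close>

definition polar_form :: "('a::field ^ 'n \<Rightarrow> 'a) \<Rightarrow> 'a ^ 'n \<Rightarrow> 'a ^ 'n \<Rightarrow> 'a" where
  "polar_form Q x y = Q (x + y) - Q x - Q y"

context
  fixes Q :: "'a::{field,finite} ^ 'n \<Rightarrow> 'a"
  assumes Q: "quadratic_form Q"
begin

lemma quadratic_form_scale: "Q (a *s x) = a ^ 2 * Q x"
proof -
  obtain c where c: "\<And>x. Q x = (\<Sum>i\<in>UNIV. \<Sum>j\<in>UNIV. c i j * x $ i * x $ j)"
    using Q unfolding quadratic_form_def by blast
  show ?thesis
    by (simp add: c sum_distrib_left power2_eq_square ac_simps)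
qed

lemma polar_form_explicit:
  "\<exists>c. \<forall>x y. polar_form Q x y = (\<Sum>i\<in>UNIV. \<Sum>j\<in>UNIV. c i j * (x $ i * y $ j + y $ i * x $ j))"
proof -
  obtain c where c: "\<And>x. Q x = (\<Sum>i\<in>UNIV. \<Sum>j\<in>UNIV. c i j * x $ i * x $ j)"
    using Q unfolding quadratic_form_def by blast
  have "polar_form Q x y = (\<Sum>i\<in>UNIV. \<Sum>j\<in>UNIV. c i j * (x $ i * y $ j + y $ i * x $ j))" for x y
    unfolding polar_form_def c sum_subtractf[symmetric]
    by (intro sum.cong refl) (simp add: algebra_simps)
  then show ?thesis by blast
qed

lemma polar_form_add: "polar_form Q x (y + z) = polar_form Q x y + polar_form Q x z"
  and polar_form_scale: "polar_form Q x (a *s y) = a * polar_form Q x y"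
proof -
  obtain c where c: "\<And>x y. polar_form Q x y =
      (\<Sum>i\<in>UNIV. \<Sum>j\<in>UNIV. c i j * (x $ i * y $ j + y $ i * x $ j))"
    using polar_form_explicit by blast
  show "polar_form Q x (y + z) = polar_form Q x y + polar_form Q x z"
    unfolding c sum.distrib[symmetric]
    by (intro sum.cong refl) (simp add: algebra_simps)
  show "polar_form Q x (a *s y) = a * polar_form Q x y"
    unfolding c sum_distrib_left
    by (intro sum.cong refl) (simp add: algebra_simps)
qed

lemma polar_form_commute: "polar_form Q x y = polar_form Q y x"
  by (simp add: polar_form_def add.commute)

lemma polar_form_add_left: "polar_form Q (x + y) z = polar_form Q x z + polar_form Q y z"
  using polar_form_add polar_form_commute by metis

lemma polar_form_scale_left: "polar_form Q (a *s x) y = a * polar_form Q x y"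
  using polar_form_scale polar_form_commute by metis

lemma quadratic_form_add: "Q (x + y) = Q x + Q y + polar_form Q x y"
  by (simp add: polar_form_def)

lemma polar_form_self: "polar_form Q x x = 2 * Q x"
proof -
  have "x + x = 2 *s x" by (metis vec.scale_left_distrib vec.scale_one one_add_one)
  then show ?thesis by (simp add: polar_form_def quadratic_form_scale)
qed

lemma span_singleton_in_zero_locus:
  assumes "x \<noteq> 0"
  shows "vec.span {x} \<in> zero_locus Q \<longleftrightarrow> Q x = 0"
  using assms by (auto simp: zero_locus_def vec.span_singleton quadratic_form_scale mem_pg_points
      intro: exI[of _ 1])

end

text \<open>In a basis adapted to \<open>p\<close> and its tangent, \<open>Q\<close> becomes xz + a
  y^2 + b yz + c z^2, which is solved for x when z is nonzero. No square is completed, so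
  characteristic 2 needs no separate treatment.\<close>

lemma conic_parametrization:
  fixes Q :: "'a::{field,finite} ^ 3 \<Rightarrow> 'a"
  assumes Q: "quadratic_form Q" and nondeg: "nondegenerate_form Q"
    and p: "p \<noteq> 0" and p_on: "vec.span {p} \<in> zero_locus Q"
  shows "\<exists>e0 e1 e2. indep3 e0 e1 e2 \<and> vec.span {e2} = vec.span {p} \<and>
    zero_locus Q = insert (vec.span {e2}) (range (\<lambda>t. vec.span {e0 + t *s e1 + t ^ 2 *s e2}))"
proof -
  let ?B = "polar_form Q"
  note bilin = polar_form_add[OF Q] polar_form_scale[OF Q] polar_form_add_left[OF Q]
    polar_form_scale_left[OF Q] quadratic_form_scale[OF Q] quadratic_form_add[OF Q]
  have Qp: "Q p = 0"
    using p p_on span_singleton_in_zero_locus[OF Q] by blast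
  then have Bpp: "?B p p = 0" using polar_form_self[OF Q] by simp
  obtain w where w: "?B p w \<noteq> 0"
    using nondeg p Qp unfolding nondegenerate_form_def polar_form_def by blast
  define w2 where "w2 = inverse (?B p w) *s w"
  have Bpw2: "?B p w2 = 1" using w by (simp add: w2_def bilin)
  have w2_notin: "w2 \<notin> vec.span {p}"
    using Bpw2 Bpp by (auto simp: vec.span_singleton bilin)
  obtain w0 where w0: "w0 \<notin> vec.span {p, w2}"
  proof -
    have "vec.dim (vec.span {p, w2}) \<noteq> vec.dim (UNIV :: ('a ^ 3) set)"
      using dim_pair[OF p w2_notin] unfolding vec_dim_card vec.dim_span
      by (simp add: insert_commute)
    then show ?thesis using that by (metis UNIV_eq_I)
  qed
  \<comment> \<open>Moves \<open>w0\<close> onto the tangent at \<open>p\<close>, the kernel of the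
    polar form with \<open>p\<close>.\<close>
  define w1 where "w1 = w0 - ?B p w0 *s w2"
  have Bpw1: "?B p w1 = 0"
    using polar_form_add[OF Q, of p w1 "?B p w0 *s w2"] by (simp add: w1_def bilin Bpw2)
  have w1_notin: "w1 \<notin> vec.span {p, w2}"
  proof
    assume "w1 \<in> vec.span {p, w2}"
    then have "w1 + ?B p w0 *s w2 \<in> vec.span {p, w2}"
      by (intro vec.span_add vec.span_scale) (auto intro: vec.span_base)
    then show False using w0 by (simp add: w1_def)
  qed
  have i: "indep3 p w2 w1"
    using p w2_notin w1_notin indep3_iff_not_in_span by blast
  define a b c where "a = Q w1" and "b = ?B w1 w2" and "c = Q w2"
  have comm: "?B w1 p = 0" "?B w2 p = 1" "?B w2 w1 = b"
    using Bpw1 Bpw2 polar_form_commute[OF Q] by (simp_all add: b_def)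
  have Q_comb: "Q (x *s p + y *s w1 + z *s w2) = x * z + y ^ 2 * a + y * z * b + z ^ 2 * c" for x y z
    by (simp add: bilin Qp Bpw1 Bpw2 algebra_simps flip: a_def b_def c_def)
  have a: "a \<noteq> 0"
  proof
    assume a0: "a = 0"
    \<comment> \<open>If \<open>a = 0\<close>, this vector is singular: \<open>Q\<close> vanishes at
      it, and so does its polar form with each of \<open>p\<close>, \<open>w2\<close>,
      \<open>w1\<close>.\<close>
    define v where "v = w1 + (- b) *s p"
    have "v \<noteq> 0"
    proof
      assume "v = 0"
      then have "w1 = b *s p" by (simp add: v_def)
      then have "w1 \<in> vec.span {p, w2}"
        by (simp add: vec.span_base vec.span_scale)
      then show False using w1_notin by blast
    qed
    moreover have "Q v = 0"
      unfolding v_def bilin using Qp comm a0 a_def by simp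
    moreover have "?B v x = 0" for x
    proof -
      obtain x1 x2 x3 where x: "x = x1 *s p + x2 *s w2 + x3 *s w1"
        using indep3_span[OF i] mem_span_triple by (metis UNIV_I)
      moreover have "?B w1 w1 = 0" using polar_form_self[OF Q, of w1] a0 a_def by simp
      ultimately show ?thesis
        unfolding v_def x bilin using comm Bpp Bpw1 Bpw2 b_def by simp
    qed
    ultimately show False
      using nondeg unfolding nondegenerate_form_def polar_form_def by blast
  qed
  \<comment> \<open>With z = -1 and y = -t the equation of the conic gives x = a t^2 + b t + c;
    these are the coefficients of that curve by powers of t, so \<open>p\<close> is the point at t =
    infinity.\<close>
  define e0 e1 e2 where "e0 = c *s p - w2" and "e1 = b *s p - w1" and "e2 = a *s p"
  have curve: "e0 + t *s e1 + t ^ 2 *s e2 = (a * t ^ 2 + b * t + c) *s p + (- t) *s w1 + (- 1) *s w2" for t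
    by (simp add: e0_def e1_def e2_def vec.scale_right_diff_distrib vec.scale_left_distrib algebra_simps)
  have nz: "e0 + t *s e1 + t ^ 2 *s e2 \<noteq> 0" for t
  proof
    assume "e0 + t *s e1 + t ^ 2 *s e2 = 0"
    then have "(a * t ^ 2 + b * t + c) *s p + (- 1) *s w2 + (- t) *s w1 = 0"
      unfolding curve by (simp add: algebra_simps)
    then show False using i unfolding indep3_def by (metis neg_equal_0_iff_equal zero_neq_one)
  qed
  have ind: "indep3 e0 e1 e2"
    unfolding indep3_def
  proof (intro allI impI)
    fix x y z assume "x *s e0 + y *s e1 + z *s e2 = 0"
    moreover have "x *s e0 + y *s e1 + z *s e2 = (x * c + y * b + z * a) *s p + (- x) *s w2 + (- y) *s w1"
      by (simp add: e0_def e1_def e2_def vec.scale_right_diff_distrib vec.scale_left_distrib algebra_simps)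
    ultimately have "x * c + y * b + z * a = 0 \<and> - x = 0 \<and> - y = 0"
      using i unfolding indep3_def by metis
    then show "x = 0 \<and> y = 0 \<and> z = 0" using a by auto
  qed
  have e2: "vec.span {e2} = vec.span {p}"
    using a by (simp add: e2_def span_scale_singleton)
  have "zero_locus Q = insert (vec.span {e2}) (range (\<lambda>t. vec.span {e0 + t *s e1 + t ^ 2 *s e2}))"
  proof (intro equalityI subsetI)
    fix P assume P: "P \<in> zero_locus Q"
    then have "P \<in> pg_points" by (simp add: zero_locus_def)
    then obtain v where v: "v \<noteq> 0" "P = vec.span {v}" using mem_pg_points by blast
    have Qv: "Q v = 0" using P v span_singleton_in_zero_locus[OF Q] by blast
    obtain x y z where xyz: "v = x *s p + z *s w2 + y *s w1"
      using indep3_span[OF i] mem_span_triple by (metis UNIV_I)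
    then have xyz: "v = x *s p + y *s w1 + z *s w2" by simp
    have eq: "x * z + y ^ 2 * a + y * z * b + z ^ 2 * c = 0"
      using Qv Q_comb xyz by simp
    show "P \<in> insert (vec.span {e2}) (range (\<lambda>t. vec.span {e0 + t *s e1 + t ^ 2 *s e2}))"
    proof (cases "z = 0")
      case True
      then have "y = 0" using eq a by simp
      then have "v = x *s p" "x \<noteq> 0" using True xyz v by auto
      then have "P = vec.span {e2}" using v e2 by (simp add: span_scale_singleton)
      then show ?thesis by blast
    next
      case False
      define t where "t = y / z"
      have y: "y = t * z" using False by (simp add: t_def)
      have "z * (x + z * (a * t ^ 2 + b * t + c)) = 0"
        using eq unfolding y by algebra
      then have x: "x = - z * (a * t ^ 2 + b * t + c)"
        using False by (simp add: eq_neg_iff_add_eq_0)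
      have "v = (- z) *s (e0 + t *s e1 + t ^ 2 *s e2)"
        unfolding curve xyz x y by (simp only: vec.scale_right_distrib vec.scale_scale) (simp add: ac_simps)
      then have "P = vec.span {e0 + t *s e1 + t ^ 2 *s e2}"
        using v False span_scale_singleton[of "- z" "e0 + t *s e1 + t ^ 2 *s e2"] by simp
      then show ?thesis by blast
    qed
  next
    fix P assume "P \<in> insert (vec.span {e2}) (range (\<lambda>t. vec.span {e0 + t *s e1 + t ^ 2 *s e2}))"
    then consider "P = vec.span {p}" | t where "P = vec.span {e0 + t *s e1 + t ^ 2 *s e2}"
      using e2 by auto
    then show "P \<in> zero_locus Q"
    proof cases
      case 1
      then show ?thesis using p_on by simp
    next
      case 2
      have "Q (e0 + t *s e1 + t ^ 2 *s e2) = 0"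
        unfolding curve Q_comb by (simp add: power2_eq_square algebra_simps)
      then show ?thesis using 2 nz span_singleton_in_zero_locus[OF Q] by blast
    qed
  qed
  then show ?thesis using ind e2 by blast
qed

section \<open>Coordinates of the Bruck-Bose representation\<close>

context cubic_extension
begin

lemma map_coords_fr_add: "map_coords fr (v + w) = map_coords fr v + map_coords fr w"
  by (simp add: map_coords_def vec_eq_iff fr_add)

lemma map_coords_fr_scale: "map_coords fr (c *s v) = fr c *s map_coords fr v"
  by (simp add: map_coords_def vec_eq_iff fr_mult)

lemma map_coords_fr_cube [simp]: "map_coords fr (map_coords fr (map_coords fr v)) = v"
  by (simp add: map_coords_def vec_eq_iff)

lemma map_coords_iota_add: "map_coords \<iota> (v + w) = map_coords \<iota> v + map_coords \<iota> w"
  by (simp add: map_coords_def vec_eq_iff iota_add)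

lemma map_coords_iota_scale: "map_coords \<iota> (c *s v) = \<iota> c *s map_coords \<iota> v"
  by (simp add: map_coords_def vec_eq_iff iota_mult)

lemma map_coords_iota_eq_iff: "map_coords \<iota> v = map_coords \<iota> w \<longleftrightarrow> v = w"
  by (simp add: map_coords_def vec_eq_iff)

lemma map_coords_fr_fixed:
  assumes "map_coords fr v = v"
  shows "\<exists>w. map_coords \<iota> w = v"
proof -
  have "v $ i \<in> range \<iota>" for i
    using assms fr_fixed_iff[of "v $ i"] by (simp add: map_coords_def vec_eq_iff)
  then have "\<iota> (inv \<iota> (v $ i)) = v $ i" for i
    by (simp add: f_inv_into_f)
  then have "map_coords \<iota> (\<chi> i. inv \<iota> (v $ i)) = v"
    by (simp add: map_coords_def vec_eq_iff)
  then show ?thesis by blast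
qed

lemma frob_card: "frob CARD('a) U = map_coords fr ` U"
  by (simp add: frob_def fr_def[abs_def])

lemma frob_card_squared: "frob (CARD('a)\<^sup>2) U = (\<lambda>v. map_coords fr (map_coords fr v)) ` U"
proof -
  have "x ^ (CARD('a)\<^sup>2) = fr (fr x)" for x
    by (simp add: fr_def power2_eq_square flip: power_mult)
  then show ?thesis by (simp add: frob_def map_coords_def)
qed

text \<open>The \<open>GF(q)\<close>-rational points of \<open>g \<oplus> g\<^sup>q \<oplus> g\<^bsup>q\<^sup>2\<^esup>\<close> are the traces \<open>w + w\<^sup>q + w\<^bsup>q\<^sup>2\<^esup>\<close> of
  vectors \<open>w\<close> of \<open>g\<close>, which identifies \<open>PG(5,q)\<close> with the affine plane over \<open>GF(q\<^sup>3)\<close> and the spread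
  with its one-dimensional subspaces.\<close>

lemma regular_2_spread_PG5_coordinates:
  fixes S0 :: "('a ^ 6) set set"
  assumes "regular_2_spread_PG5 \<iota> S0"
  shows "\<exists>M :: 'b \<Rightarrow> 'b \<Rightarrow> 'a ^ 6.
    (\<forall>x y x' y'. M (x + x') (y + y') = M x y + M x' y') \<and>
    (\<forall>c x y. M (\<iota> c * x) (\<iota> c * y) = c *s M x y) \<and>
    (\<forall>x y x' y'. M x y = M x' y' \<longrightarrow> x = x' \<and> y = y') \<and>
    (\<forall>v. \<exists>x y. v = M x y) \<and>
    S0 = {{M (c * x) (c * y) | c. True} | x y. (x, y) \<noteq> (0, 0)}"
proof -
  let ?F = "map_coords fr :: 'b ^ 6 \<Rightarrow> 'b ^ 6"
  let ?Q = "\<lambda>X. vec.span (X \<union> ?F ` X \<union> (\<lambda>v. ?F (?F v)) ` X)"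
  obtain g where g: "g \<in> pg_spaces 1" and span: "?Q g = UNIV"
    and S0: "S0 = {{v. map_coords \<iota> v \<in> ?Q X} | X. X \<in> pg_points \<and> X \<subseteq> g}"
    using assms unfolding regular_2_spread_PG5_def frob_card frob_card_squared by blast
  have g_sub: "vec.subspace g" and g_dim: "vec.dim g = 2"
    using g by (auto simp: pg_spaces_def)
  obtain B where B: "B \<subseteq> g" "vec.independent B" "g \<subseteq> vec.span B" "card B = 2"
    using vec.basis_exists[of g] g_dim by metis
  then obtain u v where uv: "B = {u, v}" "u \<noteq> v" by (meson card_2_iff)
  have g_uv: "g = vec.span {u, v}"
    using B g_sub uv vec.span_subspace by blast
  have uv_indep: "x = 0 \<and> y = 0" if "x *s u + y *s v = 0" for x y
  proof -
    have "(\<Sum>w\<in>{u, v}. (if w = u then x else y) *s w) = 0"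
      using that uv(2) by simp
    then have "(if w = u then x else y) = 0" if "w \<in> {u, v}" for w
      using vec.independentD[of B "{u, v}" "\<lambda>w. if w = u then x else y" w] B(2) uv(1) that by auto
    from this[of u] this[of v] show ?thesis using uv(2) by auto
  qed
  define w where "w x y = x *s u + y *s v" for x y
  have w_add: "w (x + x') (y + y') = w x y + w x' y'" for x y x' y'
    by (simp add: w_def vec.scale_left_distrib ac_simps)
  have w_scale: "w (c * x) (c * y) = c *s w x y" for c x y
    by (simp add: w_def vec.scale_right_distrib)
  have w_mem: "z \<in> g \<longleftrightarrow> (\<exists>x y. z = w x y)" for z
    by (simp add: g_uv mem_span_pair w_def)
  have w_eq_0: "w x y = 0 \<Longrightarrow> x = 0 \<and> y = 0" for x y
    using uv_indep by (simp add: w_def)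
  have w_inj: "x = x' \<and> y = y'" if "w x y = w x' y'" for x y x' y'
  proof -
    have "w (x - x') (y - y') + w x' y' = w x y"
      by (simp flip: w_add)
    then show ?thesis using that w_eq_0[of "x - x'" "y - y'"] by simp
  qed
  \<comment> \<open>The sum of the two conjugates of \<open>g\<close>, kept together because only
    the component in \<open>g\<close> will be compared.\<close>
  define W where "W = vec.span {?F u, ?F v, ?F (?F u), ?F (?F v)}"
  have "vec.dim W \<le> card {?F u, ?F v, ?F (?F u), ?F (?F v)}"
    unfolding W_def vec.dim_span by (rule vec.dim_le_card') simp
  also have "\<dots> \<le> 4" by (simp add: card_insert_if)
  finally have W_dim: "vec.dim W \<le> 4" .
  have W_sub: "vec.subspace W" by (simp add: W_def)
  have F_in_W: "?F z \<in> W" "?F (?F z) \<in> W" if "z \<in> g" for z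
  proof -
    obtain x y where z: "z = w x y" using \<open>z \<in> g\<close> w_mem by blast
    show "?F z \<in> W" "?F (?F z) \<in> W"
      unfolding W_def z w_def map_coords_fr_add map_coords_fr_scale
      by (intro vec.span_add vec.span_scale; simp add: vec.span_base)+
  qed
  have decomp: "?Q X \<subseteq> {x + y | x y. x \<in> X \<and> y \<in> W}" if X: "X \<subseteq> g" "vec.subspace X" for X
  proof (rule vec.span_minimal)
    show "vec.subspace {x + y | x y. x \<in> X \<and> y \<in> W}"
      using X W_sub by (intro vec.subspace_sums)
    have "0 \<in> X" "0 \<in> W" using X(2) W_sub vec.subspace_0 by blast+
    then show "X \<union> ?F ` X \<union> (\<lambda>v. ?F (?F v)) ` X \<subseteq> {x + y | x y. x \<in> X \<and> y \<in> W}"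
      using F_in_W X(1) by force
  qed
  \<comment> \<open>By dimensions: \<open>g\<close> and \<open>W\<close> span the whole space, so 6
    + dim (g Int W) = 2 + dim W, while dim W <= 4.\<close>
  have gW: "z = 0" if "z \<in> g" "z \<in> W" for z
  proof -
    have "{x + y | x y. x \<in> g \<and> y \<in> W} = UNIV"
      using decomp[OF order_refl g_sub] span by auto
    then have "vec.dim (UNIV :: ('b ^ 6) set) + vec.dim (g \<inter> W) = vec.dim g + vec.dim W"
      using vec.dim_sums_Int[OF g_sub W_sub] by metis
    then have "vec.dim (g \<inter> W) = 0"
      using g_dim W_dim unfolding vec_dim_card by (simp del: vec.dim_eq_0)
    then show ?thesis using that by auto
  qed
  \<comment> \<open>The trace, whose values have coordinates in GF(q).\<close>
  define E where "E z = z + ?F z + ?F (?F z)" for z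
  have E_add: "E (z + z') = E z + E z'" for z z'
    by (simp add: E_def map_coords_fr_add)
  have E_scale: "E (\<iota> c *s z) = \<iota> c *s E z" for c z
    by (simp add: E_def map_coords_fr_scale vec.scale_right_distrib)
  have E_fixed: "?F (E z) = E z" for z
    by (simp add: E_def map_coords_fr_add)
  \<comment> \<open>The component of \<open>E z\<close> in \<open>g\<close>, modulo
    \<open>W\<close>, is \<open>z\<close> itself. This gives both the injectivity of
    \<open>M\<close> and the shape of the spread elements.\<close>
  have E_eq: "z = z'" if "E z = z' + t" "z \<in> g" "z' \<in> g" "t \<in> W" for z z' t
  proof -
    have "z - z' = t - ?F z - ?F (?F z)"
      using that(1) by (simp add: E_def algebra_simps)
    then have "z - z' \<in> W"
      using F_in_W[OF that(2)] that(4) W_sub by (simp add: vec.subspace_diff)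
    moreover have "z - z' \<in> g" using that g_sub by (simp add: vec.subspace_diff)
    ultimately show ?thesis using gW by (metis right_minus_eq)
  qed
  define M where "M x y = (SOME v. map_coords \<iota> v = E (w x y))" for x y
  have M: "map_coords \<iota> (M x y) = E (w x y)" for x y
    unfolding M_def using map_coords_fr_fixed[OF E_fixed] by (rule someI_ex)
  have M_add: "M (x + x') (y + y') = M x y + M x' y'" for x y x' y'
    by (subst map_coords_iota_eq_iff[symmetric])
      (simp add: map_coords_iota_add M w_add E_add)
  have M_scale: "M (\<iota> c * x) (\<iota> c * y) = c *s M x y" for c x y
    by (subst map_coords_iota_eq_iff[symmetric])
      (simp add: map_coords_iota_scale M w_scale E_scale)
  have M_inj: "x = x' \<and> y = y'" if "M x y = M x' y'" for x y x' y'
  proof -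
    have "E (w x y) = w x' y' + (?F (w x' y') + ?F (?F (w x' y')))"
      using arg_cong[OF that, of "map_coords \<iota>"] by (simp add: M E_def)
    moreover have "w x y \<in> g" "w x' y' \<in> g" using w_mem by blast+
    moreover from this have "?F (w x' y') + ?F (?F (w x' y')) \<in> W"
      using F_in_W W_sub by (simp add: vec.subspace_add)
    ultimately have "w x y = w x' y'" by (rule E_eq)
    then show ?thesis using w_inj by simp
  qed
  have M_surj: "\<exists>x y. z = M x y" for z
  proof -
    have "inj (\<lambda>(x, y). M x y)"
      using M_inj by (auto intro!: injI)
    then have "card (range (\<lambda>(x, y). M x y)) = CARD('b \<times> 'b)"
      by (rule card_image)
    also have "\<dots> = CARD('a ^ 6)"
      by (simp add: card_ext flip: power_mult power_add)
    finally have "range (\<lambda>(x, y). M x y) = UNIV"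
      by (intro card_subset_eq) auto
    then have "z \<in> range (\<lambda>(x, y). M x y)" by simp
    then show ?thesis by auto
  qed
  have element: "{z. map_coords \<iota> z \<in> ?Q (vec.span {w x y})} = {M (c * x) (c * y) | c. True}" for x y
  proof (intro equalityI subsetI)
    fix z assume "z \<in> {M (c * x) (c * y) | c. True}"
    then obtain c where z: "z = M (c * x) (c * y)" by blast
    let ?X = "vec.span {w x y}"
    have "w (c * x) (c * y) \<in> ?X"
      by (simp add: w_scale scale_mem_span_singleton)
    then have "w (c * x) (c * y) \<in> ?Q ?X" "?F (w (c * x) (c * y)) \<in> ?Q ?X"
      "?F (?F (w (c * x) (c * y))) \<in> ?Q ?X"
      by (blast intro: vec.span_base)+
    then show "z \<in> {z. map_coords \<iota> z \<in> ?Q ?X}"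
      unfolding z mem_Collect_eq M E_def by (blast intro: vec.span_add)
  next
    fix z assume "z \<in> {z. map_coords \<iota> z \<in> ?Q (vec.span {w x y})}"
    then have z: "map_coords \<iota> z \<in> ?Q (vec.span {w x y})" by simp
    obtain x' y' where z': "z = M x' y'" using M_surj by blast
    have sub: "vec.span {w x y} \<subseteq> g"
      using w_mem g_sub by (intro vec.span_minimal) auto
    then obtain r t where rt: "E (w x' y') = r + t" "r \<in> vec.span {w x y}" "t \<in> W"
      using z decomp[OF sub] unfolding z' M by blast
    moreover have "w x' y' \<in> g" "r \<in> g"
      using w_mem sub rt(2) by blast+
    \<comment> \<open>Comparing components in \<open>g\<close> shows that the vector whose trace is
      taken already lies in the point X.\<close>
    ultimately have "w x' y' = r"
      using E_eq by blast
    then obtain c where "w x' y' = w (c * x) (c * y)"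
      using rt(2) by (auto simp: vec.span_singleton w_scale)
    then show "z \<in> {M (c * x) (c * y) | c. True}"
      using w_inj z' by blast
  qed
  have w_nz: "w x y \<noteq> 0 \<longleftrightarrow> (x, y) \<noteq> (0, 0)" for x y
    using w_eq_0[of x y] by (auto simp: w_def)
  have points: "X \<in> pg_points \<and> X \<subseteq> g \<longleftrightarrow> (\<exists>x y. (x, y) \<noteq> (0, 0) \<and> X = vec.span {w x y})" for X
  proof
    assume X: "X \<in> pg_points \<and> X \<subseteq> g"
    then obtain z where z: "z \<noteq> 0" "X = vec.span {z}" using mem_pg_points by blast
    then have "z \<in> g" using X vec.span_base by blast
    then obtain x y where "z = w x y" using w_mem by blast
    then show "\<exists>x y. (x, y) \<noteq> (0, 0) \<and> X = vec.span {w x y}"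
      using z w_nz by blast
  next
    assume "\<exists>x y. (x, y) \<noteq> (0, 0) \<and> X = vec.span {w x y}"
    then obtain x y where xy: "(x, y) \<noteq> (0, 0)" "X = vec.span {w x y}" by blast
    have "w x y \<in> g" using w_mem by blast
    then have "X \<subseteq> g" unfolding xy(2) using g_sub by (intro vec.span_minimal) auto
    then show "X \<in> pg_points \<and> X \<subseteq> g"
      using xy w_nz by simp
  qed
  have "S0 = {{M (c * x) (c * y) | c. True} | x y. (x, y) \<noteq> (0, 0)}"
    unfolding S0 points element[symmetric] by blast
  then show ?thesis using M_add M_scale M_inj M_surj by blast
qed

end

text \<open>The \<open>GF(q)\<close>-space is \<open>GF(q\<^sup>3) \<oplus> GF(q\<^sup>3) \<oplus> GF(q)\<close>, embedded in the coordinate space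
  of \<open>PG(2,q\<^sup>3)\<close>.\<close>

locale bb_coordinates = cubic_extension \<iota>
  for \<iota> :: "'a::{field,finite} \<Rightarrow> 'b::{field,finite}" +
  fixes H :: "('a ^ 7) set" and S :: "('a ^ 7) set set" and \<Lambda> :: "'a ^ 7 \<Rightarrow> 'b ^ 3"
  assumes coord_add: "\<Lambda> (v + w) = \<Lambda> v + \<Lambda> w"
    and coord_scale: "\<Lambda> (c *s v) = \<iota> c *s \<Lambda> v"
    and inj_coord: "inj \<Lambda>"
    and range_coord: "range \<Lambda> = {z. z $ 3 \<in> range \<iota>}"
    and dim_hyperplane: "vec.dim H = 6"
    and hyperplane: "H = {v. \<Lambda> v $ 3 = 0}"
    and spread: "S = {{v. \<Lambda> v \<in> X} | X. X \<in> pg_points \<and> X \<subseteq> {z. z $ 3 = 0}}"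

text \<open>A vector \<open>v0\<close> outside \<open>H\<close> supplies the seventh coordinate:
  every vector is uniquely T (M x y) + c v0, and (x, y, c) are its coordinates.\<close>

lemma (in cubic_extension) ex_bb_coordinates:
  assumes H: "H \<in> pg_spaces 5" and S: "regular_2_spread \<iota> H S"
  shows "\<exists>\<Lambda>. bb_coordinates \<iota> H S \<Lambda>"
proof -
  obtain T :: "'a ^ 6 \<Rightarrow> 'a ^ 7" and S0 where T: "Vector_Spaces.linear (*s) (*s) T" "inj T" "range T = H"
    and S0: "regular_2_spread_PG5 \<iota> S0" and S_eq: "S = (\<lambda>\<pi>. T ` \<pi>) ` S0"
    using S unfolding regular_2_spread_def by blast
  obtain M where M_add: "\<And>x y x' y'. M (x + x') (y + y') = M x y + M x' y'"
    and M_scale: "\<And>c x y. M (\<iota> c * x) (\<iota> c * y) = c *s M x y"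
    and M_inj: "\<And>x y x' y'. M x y = M x' y' \<Longrightarrow> x = x' \<and> y = y'"
    and M_surj: "\<And>v. \<exists>x y. v = M x y"
    and S0_eq: "S0 = {{M (c * x) (c * y) | c. True} | x y. (x, y) \<noteq> (0, 0)}"
    using regular_2_spread_PG5_coordinates[OF S0] by blast
  have H_sub: "vec.subspace H" and H_dim: "vec.dim H = 6"
    using H by (auto simp: pg_spaces_def)
  have "H \<noteq> UNIV" using H_dim vec_dim_card[where 'a = 'a and 'n = 7] by auto
  then obtain v0 where v0: "v0 \<notin> H" by blast
  have T_add: "T (v + w) = T v + T w" and T_scale: "T (c *s v) = c *s T v" for v w c
    using T(1) by (simp_all add: vec.linear_add vec.linear_scale)
  define N where "N x y c = T (M x y) + c *s v0" for x y c
  have TH: "T v \<in> H" for v using T(3) by auto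
  have N_H: "N x y c \<in> H \<longleftrightarrow> c = 0" for x y c
  proof
    assume "N x y c \<in> H"
    then have "c *s v0 \<in> H"
      using TH[of "M x y"] H_sub vec.subspace_diff by (fastforce simp: N_def)
    then have "inverse c *s (c *s v0) \<in> H"
      by (rule vec.subspace_scale[OF H_sub])
    then show "c = 0" using v0 by (metis left_inverse vec.scale_one vec.scale_scale)
  qed (simp add: N_def TH)
  have N_add: "N x y c + N x' y' c' = N (x + x') (y + y') (c + c')" for x y c x' y' c'
    by (simp add: N_def M_add T_add vec.scale_left_distrib ac_simps)
  have N_scale: "d *s N x y c = N (\<iota> d * x) (\<iota> d * y) (d * c)" for d x y c
    by (simp add: N_def M_scale T_scale vec.scale_right_distrib)
  have N_inj: "x = x' \<and> y = y' \<and> c = c'" if "N x y c = N x' y' c'" for x y c x' y' c'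
  proof -
    have "N (x - x') (y - y') (c - c') + N x' y' c' = N x y c"
      by (simp add: N_add)
    then have 0: "N (x - x') (y - y') (c - c') = 0" using that by simp
    then have c: "c = c'" using N_H vec.subspace_0[OF H_sub] by (metis right_minus_eq)
    then show ?thesis
      using that T(2) M_inj by (simp add: N_def inj_eq)
  qed
  have N_surj: "\<exists>x y c. v = N x y c" for v
  proof -
    have "inj (\<lambda>(x, y, c). N x y c)"
      using N_inj by (auto intro!: injI)
    then have "card (range (\<lambda>(x, y, c). N x y c)) = CARD('b \<times> 'b \<times> 'a)"
      by (rule card_image)
    also have "\<dots> = CARD('a ^ 7)"
      by (simp add: card_ext flip: power_mult power_add power_Suc2)
    finally have "range (\<lambda>(x, y, c). N x y c) = UNIV"
      by (intro card_subset_eq) auto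
    then have "v \<in> range (\<lambda>(x, y, c). N x y c)" by simp
    then show ?thesis by auto
  qed
  \<comment> \<open>The inverse of the bijection \<open>N\<close>, with its third argument pushed
    into GF(q^3).\<close>
  define \<Lambda> :: "'a ^ 7 \<Rightarrow> 'b ^ 3" where
    "\<Lambda> v = (SOME z. \<exists>x y c. v = N x y c \<and> z = vector [x, y, \<iota> c])" for v
  have \<Lambda>: "\<Lambda> (N x y c) = vector [x, y, \<iota> c]" for x y c
    unfolding \<Lambda>_def
  proof (rule some_equality)
    fix z :: "'b ^ 3" assume "\<exists>x' y' c'. N x y c = N x' y' c' \<and> z = vector [x', y', \<iota> c']"
    then show "z = vector [x, y, \<iota> c]" using N_inj by blast
  qed blast
  have T_range: "v \<in> range T \<longleftrightarrow> (\<exists>x y. v = N x y 0)" for v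
    using N_H N_surj T(3) by metis
  have element: "T ` {M (c * x) (c * y) | c. True} = {v. \<Lambda> v \<in> vec.span {vector [x, y, 0]}}" for x y
  proof (intro equalityI subsetI)
    fix v assume "v \<in> T ` {M (c * x) (c * y) | c. True}"
    then obtain c where "v = N (c * x) (c * y) 0" by (auto simp: N_def)
    then show "v \<in> {v. \<Lambda> v \<in> vec.span {vector [x, y, 0]}}"
      by (auto simp: \<Lambda> vec.span_singleton vector_3_simps)
  next
    fix v assume "v \<in> {v. \<Lambda> v \<in> vec.span {vector [x, y, 0]}}"
    moreover obtain x' y' c' where v: "v = N x' y' c'" using N_surj by blast
    ultimately have "\<exists>c. x' = c * x \<and> y' = c * y \<and> c' = 0"
      by (auto simp: \<Lambda> vec.span_singleton vector_3_simps)
    then obtain c where "x' = c * x" "y' = c * y" "c' = 0" by blast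
    then show "v \<in> T ` {M (c * x) (c * y) | c. True}"
      using v by (auto simp: N_def)
  qed
  have points: "X \<in> pg_points \<and> X \<subseteq> {z. z $ 3 = 0} \<longleftrightarrow>
      (\<exists>x y. (x, y) \<noteq> (0, 0) \<and> X = vec.span {vector [x, y, 0]})" for X :: "('b ^ 3) set"
  proof
    assume X: "X \<in> pg_points \<and> X \<subseteq> {z. z $ 3 = 0}"
    then obtain z where z: "z \<noteq> 0" "X = vec.span {z}" using mem_pg_points by blast
    then have "z $ 3 = 0" using X vec.span_base by blast
    then have "z = vector [z $ 1, z $ 2, 0]" by (simp add: vec3_eq_iff)
    then show "\<exists>x y. (x, y) \<noteq> (0, 0) \<and> X = vec.span {vector [x, y, 0]}"
      using z by (metis Pair_inject vector_3_simps(3))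
  next
    assume "\<exists>x y. (x, y) \<noteq> (0, 0) \<and> X = vec.span {vector [x, y, 0]}"
    then obtain x y where xy: "(x, y) \<noteq> (0, 0)" "X = vec.span {vector [x, y, 0]}" by blast
    then have "X \<in> pg_points"
      using vector_3_simps(3)[of x y 0] by simp
    moreover have "X \<subseteq> {z. z $ 3 = 0}"
      unfolding xy(2) by (auto simp: vec.span_singleton)
    ultimately show "X \<in> pg_points \<and> X \<subseteq> {z. z $ 3 = 0}" by blast
  qed
  have "bb_coordinates \<iota> H S \<Lambda>"
  proof unfold_locales
    show "\<Lambda> (v + w) = \<Lambda> v + \<Lambda> w" for v w
      using N_surj[of v] N_surj[of w] by (auto simp: N_add \<Lambda> vector_3_simps iota_add)
    show "\<Lambda> (c *s v) = \<iota> c *s \<Lambda> v" for c v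
      using N_surj[of v] by (auto simp: N_scale \<Lambda> vector_3_simps iota_mult)
    show "inj \<Lambda>"
    proof (rule injI)
      fix v w assume "\<Lambda> v = \<Lambda> w"
      then show "v = w"
        using N_surj[of v] N_surj[of w] by (auto simp: \<Lambda> vector_3_simps)
    qed
    show "range \<Lambda> = {z. z $ 3 \<in> range \<iota>}"
    proof (intro equalityI subsetI)
      fix z assume "z \<in> range \<Lambda>"
      then obtain v where "z = \<Lambda> v" by blast
      then show "z \<in> {z. z $ 3 \<in> range \<iota>}" using N_surj[of v] by (auto simp: \<Lambda> vector_3)
    next
      fix z :: "'b ^ 3" assume "z \<in> {z. z $ 3 \<in> range \<iota>}"
      then obtain c where "z $ 3 = \<iota> c" by blast
      then have "z = \<Lambda> (N (z $ 1) (z $ 2) c)" by (simp add: \<Lambda> vec3_eq_iff vector_3)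
      then show "z \<in> range \<Lambda>" by blast
    qed
    show "vec.dim H = 6" by (rule H_dim)
    show "H = {v. \<Lambda> v $ 3 = 0}"
      using N_H N_surj by (auto simp: \<Lambda> vector_3) (metis \<Lambda> iota_eq_0_iff vector_3(3))+
    show "S = {{v. \<Lambda> v \<in> X} | X. X \<in> pg_points \<and> X \<subseteq> {z. z $ 3 = 0}}"
      unfolding S_eq S0_eq points using element by blast
  qed
  then show ?thesis by blast
qed

section \<open>The canonical identification of the Bruck-Bose plane with PG(2,q^3)\<close>

context bb_coordinates
begin

lemma coord_0 [simp]: "\<Lambda> 0 = 0"
  using coord_add[of 0 0] by simp

lemma coord_eq_iff [simp]: "\<Lambda> v = \<Lambda> w \<longleftrightarrow> v = w"
  using inj_coord by (auto dest: injD)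

lemma coord_eq_0_iff [simp]: "\<Lambda> v = 0 \<longleftrightarrow> v = 0"
  using coord_eq_iff[of v 0] by simp

lemma coord_diff: "\<Lambda> (v - w) = \<Lambda> v - \<Lambda> w"
  using coord_add[of "v - w" w] by simp

lemma coord_sum: "\<Lambda> (sum f A) = (\<Sum>x\<in>A. \<Lambda> (f x))"
  by (induction A rule: infinite_finite_induct) (simp_all add: coord_add)

lemma ex_coord: "z $ 3 \<in> range \<iota> \<Longrightarrow> \<exists>v. \<Lambda> v = z"
  using range_coord by (metis (mono_tags, lifting) mem_Collect_eq rangeE)

lemma coord_third: "\<exists>c. \<Lambda> v $ 3 = \<iota> c"
  using range_coord by blast

lemma subspace_coord_vimage:
  assumes "vec.subspace X"
  shows "vec.subspace {v. \<Lambda> v \<in> X}"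
  using assms by (auto intro!: vec.subspaceI simp: coord_add coord_scale
      vec.subspace_0 vec.subspace_add vec.subspace_scale)

lemma subspace_third_eq_0: "vec.subspace {z :: 'b ^ 3. z $ 3 = 0}"
  by (auto intro!: vec.subspaceI)

lemma subspace_hyperplane: "vec.subspace H"
  using subspace_coord_vimage[OF subspace_third_eq_0] by (simp add: hyperplane)

text \<open>One formula for both kinds of points: an affine point is extended from a GF(q)-line to a
  GF(q^3)-line, while the image of a spread element is a GF(q^3)-line already. The line at infinity
  becomes the line of vanishing third coordinate.\<close>

definition bb_point :: "('a ^ 7) set \<Rightarrow> ('b ^ 3) set" where
  "bb_point P = vec.span (\<Lambda> ` P)"

lemma bb_point_span_singleton: "bb_point (vec.span {v}) = vec.span {\<Lambda> v}"
  unfolding bb_point_def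
proof (rule antisym)
  show "vec.span (\<Lambda> ` vec.span {v}) \<subseteq> vec.span {\<Lambda> v}"
  proof (rule vec.span_minimal)
    show "\<Lambda> ` vec.span {v} \<subseteq> vec.span {\<Lambda> v}"
      by (auto simp: vec.span_singleton coord_scale)
  qed simp
  show "vec.span {\<Lambda> v} \<subseteq> vec.span (\<Lambda> ` vec.span {v})"
    by (rule vec.span_mono) (auto intro: vec.span_base)
qed

lemma coord_image_vimage: "X \<subseteq> {z. z $ 3 = 0} \<Longrightarrow> \<Lambda> ` {v. \<Lambda> v \<in> X} = X"
proof -
  assume X: "X \<subseteq> {z. z $ 3 = 0}"
  have "z \<in> range \<Lambda>" if "z \<in> X" for z
    using X that rangeI[of \<iota> 0] unfolding range_coord by auto
  then show ?thesis by auto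
qed

lemma bb_point_spread_element:
  assumes "vec.subspace X" and "X \<subseteq> {z. z $ 3 = 0}"
  shows "bb_point {v. \<Lambda> v \<in> X} = X"
  using assms by (simp add: bb_point_def coord_image_vimage)

lemma affine_points_iff: "P \<in> affine_points H \<longleftrightarrow> (\<exists>v. v \<notin> H \<and> P = vec.span {v})"
proof
  assume P: "P \<in> affine_points H"
  then have "P \<in> pg_points" and not_sub: "\<not> P \<subseteq> H" by (auto simp: affine_points_def)
  then obtain v where v: "P = vec.span {v}" using mem_pg_points by blast
  then have "v \<notin> H"
    using not_sub vec.span_minimal[of "{v}" H] subspace_hyperplane by auto
  then show "\<exists>v. v \<notin> H \<and> P = vec.span {v}" using v by blast
next
  assume "\<exists>v. v \<notin> H \<and> P = vec.span {v}"
  then obtain v where v: "v \<notin> H" "P = vec.span {v}" by blast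
  moreover have "v \<noteq> 0" using v vec.subspace_0[OF subspace_hyperplane] by blast
  ultimately show "P \<in> affine_points H"
    unfolding affine_points_def using vec.span_base[of v "{v}"] by auto
qed

lemma spread_iff: "\<pi> \<in> S \<longleftrightarrow> (\<exists>x. x \<noteq> 0 \<and> x $ 3 = 0 \<and> \<pi> = {v. \<Lambda> v \<in> vec.span {x}})"
proof
  assume "\<pi> \<in> S"
  then obtain X where X: "X \<in> pg_points" "X \<subseteq> {z. z $ 3 = 0}" "\<pi> = {v. \<Lambda> v \<in> X}"
    using spread by blast
  then obtain x where x: "x \<noteq> 0" "X = vec.span {x}" using mem_pg_points by blast
  then have "x $ 3 = 0" using X vec.span_base by blast
  then show "\<exists>x. x \<noteq> 0 \<and> x $ 3 = 0 \<and> \<pi> = {v. \<Lambda> v \<in> vec.span {x}}"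
    using X x by blast
next
  assume "\<exists>x. x \<noteq> 0 \<and> x $ 3 = 0 \<and> \<pi> = {v. \<Lambda> v \<in> vec.span {x}}"
  then obtain x where x: "x \<noteq> 0" "x $ 3 = 0" "\<pi> = {v. \<Lambda> v \<in> vec.span {x}}" by blast
  then have "vec.span {x} \<subseteq> {z. z $ 3 = 0}"
    by (intro vec.span_minimal subspace_third_eq_0) auto
  then show "\<pi> \<in> S" using x spread by auto
qed

lemma span_third_eq_0: "x $ 3 = 0 \<Longrightarrow> vec.span {x :: 'b ^ 3} \<subseteq> {z. z $ 3 = 0}"
  by (intro vec.span_minimal subspace_third_eq_0) auto

lemma bb_point_vimage: "x $ 3 = 0 \<Longrightarrow> bb_point {v. \<Lambda> v \<in> vec.span {x}} = vec.span {x}"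
  by (intro bb_point_spread_element span_third_eq_0) auto

lemma bb_points_cases:
  assumes "P \<in> bb_points H S"
  obtains (affine) v where "\<Lambda> v $ 3 \<noteq> 0" "P = vec.span {v}" "bb_point P = vec.span {\<Lambda> v}"
    "P \<in> affine_points H"
  | (spread) x where "x \<noteq> 0" "x $ 3 = 0" "P = {v. \<Lambda> v \<in> vec.span {x}}" "bb_point P = vec.span {x}"
    "P \<in> S"
proof (cases "P \<in> S")
  case True
  then show ?thesis using spread_iff that(2) bb_point_vimage by metis
next
  case False
  then have "P \<in> affine_points H" using assms by (simp add: bb_points_def)
  then obtain v where "v \<notin> H" "P = vec.span {v}" using affine_points_iff by blast
  then show ?thesis
    using that(1) bb_point_span_singleton \<open>P \<in> affine_points H\<close> by (simp add: hyperplane)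
qed

lemma bb_point_in_pg_points: "P \<in> bb_points H S \<Longrightarrow> bb_point P \<in> pg_points"
  by (erule bb_points_cases) (metis span_singleton_in_pg_points zero_index)+

text \<open>The factor between the two coordinate vectors is a quotient of their nonzero third
  coordinates, which are rational; so it lies in GF(q) and the vectors are proportional
  there.\<close>

lemma affine_point_eq:
  assumes "\<Lambda> v $ 3 \<noteq> 0" and "\<Lambda> w $ 3 \<noteq> 0" and "vec.span {\<Lambda> v} = vec.span {\<Lambda> w}"
  shows "vec.span {v} = vec.span {w}"
proof -
  have nz: "v \<noteq> 0" "w \<noteq> 0" "\<Lambda> v \<noteq> 0" "\<Lambda> w \<noteq> 0" using assms by auto
  then obtain c where c: "c \<noteq> 0" "\<Lambda> w = c *s \<Lambda> v"
    using assms(3) span_singleton_eq_iff by blast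
  obtain a b where ab: "\<Lambda> v $ 3 = \<iota> a" "\<Lambda> w $ 3 = \<iota> b" using coord_third by metis
  have "c * \<iota> a = \<iota> b" using c(2) ab by (metis vector_smult_component)
  moreover have "a \<noteq> 0" using ab assms by auto
  ultimately have "c = \<iota> (b / a)"
    by (metis iota_eq_0_iff iota_mult nonzero_eq_divide_eq nonzero_mult_div_cancel_right)
  then have "\<Lambda> w = \<Lambda> ((b / a) *s v)" using c by (simp add: coord_scale)
  then have "w = (b / a) *s v" "b / a \<noteq> 0" using nz by auto
  then show ?thesis using span_singleton_eq_iff nz by blast
qed

lemma inj_on_bb_point: "inj_on bb_point (bb_points H S)"
proof (rule inj_onI)
  fix P P' assume P: "P \<in> bb_points H S" and P': "P' \<in> bb_points H S" and eq: "bb_point P = bb_point P'"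
  show "P = P'"
    using P
  proof (cases rule: bb_points_cases)
    case P: (affine v)
    show ?thesis
      using P'
    proof (cases rule: bb_points_cases)
      case (affine w)
      have "vec.span {\<Lambda> v} = vec.span {\<Lambda> w}" using P(3) affine(3) eq by metis
      then show ?thesis using affine_point_eq[OF P(1) affine(1)] P(2) affine(2) by metis
    next
      case (spread x)
      then have "\<Lambda> v \<in> vec.span {x}" using P eq vec.span_base by blast
      then show ?thesis using span_third_eq_0[OF spread(2)] P by auto
    qed
  next
    case P: (spread y)
    show ?thesis
      using P'
    proof (cases rule: bb_points_cases)
      case (affine w)
      then have "\<Lambda> w \<in> vec.span {y}" using P eq vec.span_base by blast
      then show ?thesis using span_third_eq_0[OF P(2)] affine by auto
    next
      case (spread x)
      then show ?thesis using P eq by simp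
    qed
  qed
qed

lemma span_pair_third_eq_0:
  assumes "x \<noteq> 0" and "x $ 3 = 0" and "y $ 3 = 0" and "y \<notin> vec.span {x}"
  shows "vec.span {x, y} = {z :: 'b ^ 3. z $ 3 = 0}"
proof (rule vec.subspace_dim_equal)
  show "vec.span {x, y} \<subseteq> {z :: 'b ^ 3. z $ 3 = 0}"
    using assms by (intro vec.span_minimal subspace_third_eq_0) auto
  have "{z :: 'b ^ 3. z $ 3 = 0} = {z. \<forall>i. i \<notin> {1, 2} \<longrightarrow> z $ i = 0}"
    by (auto simp: forall_3)
  then have "vec.dim {z :: 'b ^ 3. z $ 3 = 0} = 2"
    by (simp only: dim_substandard_cart) simp
  then show "vec.dim {z :: 'b ^ 3. z $ 3 = 0} \<le> vec.dim (vec.span {x, y})"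
    using dim_pair[OF assms(1,4)] by (simp add: insert_commute)
qed (use subspace_third_eq_0 in auto)

text \<open>Any two distinct spread elements are complementary in the hyperplane, and there are at least
  three of them.\<close>

lemma dim_spread_element:
  assumes "x \<noteq> 0" and "x $ 3 = 0"
  shows "vec.dim {v. \<Lambda> v \<in> vec.span {x}} = 3"
proof -
  let ?\<pi> = "\<lambda>x. {v. \<Lambda> v \<in> vec.span {x}}"
  have sum: "vec.dim (?\<pi> x) + vec.dim (?\<pi> y) = 6"
    if x: "x \<noteq> 0" "x $ 3 = 0" and y: "y $ 3 = 0" "y \<notin> vec.span {x}" for x y
  proof -
    have "{v + w | v w. v \<in> ?\<pi> x \<and> w \<in> ?\<pi> y} = H"
    proof (intro equalityI subsetI)
      fix u assume "u \<in> {v + w | v w. v \<in> ?\<pi> x \<and> w \<in> ?\<pi> y}"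
      then show "u \<in> H"
        using span_third_eq_0[OF x(2)] span_third_eq_0[OF y(1)] by (force simp: hyperplane coord_add)
    next
      fix u assume "u \<in> H"
      then have "\<Lambda> u \<in> vec.span {x, y}"
        using span_pair_third_eq_0[OF x y] by (simp add: hyperplane)
      then obtain a b where ab: "\<Lambda> u = a *s x + b *s y" using mem_span_pair by blast
      have "(a *s x) $ 3 = \<iota> 0" "(b *s y) $ 3 = \<iota> 0" using x y by simp_all
      then obtain v w where vw: "\<Lambda> v = a *s x" "\<Lambda> w = b *s y" using ex_coord by (metis rangeI)
      then have "u = v + w" using ab by (metis coord_add coord_eq_iff)
      then show "u \<in> {v + w | v w. v \<in> ?\<pi> x \<and> w \<in> ?\<pi> y}"
        using vw scale_mem_span_singleton by fastforce
    qed
    moreover have "?\<pi> x \<inter> ?\<pi> y \<subseteq> {0}"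
    proof
      fix v assume "v \<in> ?\<pi> x \<inter> ?\<pi> y"
      then have v: "\<Lambda> v \<in> vec.span {x}" "\<Lambda> v \<in> vec.span {y}" by auto
      have "\<Lambda> v = 0"
      proof (rule ccontr)
        assume "\<Lambda> v \<noteq> 0"
        then have "vec.span {x} = vec.span {y}" using v span_singleton_eq_of_mem by metis
        then show False using y vec.span_base by blast
      qed
      then show "v \<in> {0}" by simp
    qed
    then have "vec.dim (?\<pi> x \<inter> ?\<pi> y) = 0" by simp
    moreover have "vec.subspace (?\<pi> x)" "vec.subspace (?\<pi> y)"
      by (simp_all add: subspace_coord_vimage)
    ultimately show ?thesis
      using vec.dim_sums_Int[of "?\<pi> x" "?\<pi> y"] dim_hyperplane by (simp del: vec.dim_eq_0)
  qed
  let ?e1 = "vector [1, 0, 0] :: 'b ^ 3" and ?e2 = "vector [0, 1, 0] :: 'b ^ 3"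
    and ?e3 = "vector [1, 1, 0] :: 'b ^ 3"
  have nz: "?e1 \<noteq> 0" "?e2 \<noteq> 0" "?e3 \<noteq> 0" by (simp_all add: vector_3_simps)
  have e0: "?e1 $ 3 = 0" "?e2 $ 3 = 0" "?e3 $ 3 = 0" by simp_all
  have e: "?e2 \<notin> vec.span {?e1}" "?e3 \<notin> vec.span {?e1}" "?e3 \<notin> vec.span {?e2}"
    by (auto simp: vec.span_singleton vector_3_simps)
  \<comment> \<open>Three pairwise sums equal to 6 force each of the dimensions to be 3.\<close>
  have 3: "vec.dim (?\<pi> ?e1) = 3" "vec.dim (?\<pi> ?e2) = 3"
    using sum[OF nz(1) e0(1,2) e(1)] sum[OF nz(1) e0(1,3) e(2)] sum[OF nz(2) e0(2,3) e(3)]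
    by linarith+
  show ?thesis
  proof (cases "?e1 \<in> vec.span {x}")
    case False
    then show ?thesis using sum[OF assms e0(1)] 3 by linarith
  next
    case True
    then have "vec.span {?e1} = vec.span {x}" using nz span_singleton_eq_of_mem by blast
    then show ?thesis using 3 by simp
  qed
qed

text \<open>By dimension, a 3-space through a spread element meets \<open>H\<close> exactly in it,
  so this element and one vector \<open>v\<close> off \<open>H\<close> generate it; over GF(q^3) the
  image is spanned by two vectors.\<close>

lemma bb_lines_imp_pg_line:
  assumes "l \<in> bb_lines H S"
  shows "\<exists>l'\<in>pg_lines. bb_point ` l \<subseteq> l'"
proof -
  consider "l = S" | L \<pi> where "l = {P \<in> bb_points H S. P \<subseteq> L}" "L \<in> pg_spaces 3" "\<not> L \<subseteq> H"
    "\<pi> \<in> S" "\<pi> \<subseteq> L"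
    using assms unfolding bb_lines_def by blast
  then show ?thesis
  proof cases
    case 1
    let ?e1 = "vector [1, 0, 0] :: 'b ^ 3" and ?e2 = "vector [0, 1, 0] :: 'b ^ 3"
    have e: "?e1 \<noteq> 0" "?e1 $ 3 = 0" "?e2 $ 3 = 0" "?e2 \<notin> vec.span {?e1}"
      by (auto simp: vec.span_singleton vector_3_simps)
    have "bb_point P \<in> {P \<in> pg_points. P \<subseteq> vec.span {?e1, ?e2}}" if "P \<in> S" for P
    proof -
      obtain x where x: "x \<noteq> 0" "x $ 3 = 0" "P = {v. \<Lambda> v \<in> vec.span {x}}"
        using \<open>P \<in> S\<close> spread_iff by blast
      then show ?thesis
        unfolding span_pair_third_eq_0[OF e] using span_third_eq_0 bb_point_vimage by simp
    qed
    then show ?thesis using 1 pg_line_through(1)[OF e(1,4)] by blast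
  next
    case (2 L \<pi>)
    obtain x where x: "x \<noteq> 0" "x $ 3 = 0" "\<pi> = {v. \<Lambda> v \<in> vec.span {x}}"
      using 2 spread_iff by blast
    have L: "vec.subspace L" "vec.dim L = 4" using 2 by (auto simp: pg_spaces_def)
    obtain v where v: "v \<in> L" "v \<notin> H" using 2 by blast
    have v3: "\<Lambda> v $ 3 \<noteq> 0" using v by (simp add: hyperplane)
    have sub: "vec.subspace (L \<inter> H)" using L subspace_hyperplane by (intro vec.subspace_inter)
    have "vec.dim (L \<inter> H) < 4"
    proof -
      have "vec.dim (insert v (L \<inter> H)) = vec.dim (L \<inter> H) + 1"
        using v sub by (simp add: vec.dim_insert vec.span_eq_iff[THEN iffD2])
      moreover have "vec.dim (insert v (L \<inter> H)) \<le> vec.dim L"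
        using v by (intro vec.dim_subset) auto
      ultimately show ?thesis using L by simp
    qed
    then have "\<pi> = L \<inter> H"
      using dim_spread_element[OF x(1,2)] sub x 2 span_third_eq_0[OF x(2)] subspace_coord_vimage
      by (intro vec.subspace_dim_equal) (auto simp: hyperplane)
    have x_notin: "x \<notin> vec.span {\<Lambda> v}"
    proof
      assume "x \<in> vec.span {\<Lambda> v}"
      then obtain c where "x = c *s \<Lambda> v" by (auto simp: vec.span_singleton)
      then show False using x v3 by auto
    qed
    have v_nz: "\<Lambda> v \<noteq> 0" using v3 by auto
    \<comment> \<open>Subtracting the rational multiple of \<open>v\<close> with the same third
      coordinate moves \<open>w\<close> into \<open>H\<close>, hence into the spread
      element.\<close>
    have in_span: "\<Lambda> w \<in> vec.span {\<Lambda> v, x}" if "w \<in> L" for w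
    proof -
      obtain a b where ab: "\<Lambda> v $ 3 = \<iota> a" "\<Lambda> w $ 3 = \<iota> b" using coord_third by metis
      have "a \<noteq> 0" using v3 ab by auto
      have "w - (b / a) *s v \<in> L"
        using that v L by (simp add: vec.subspace_diff vec.subspace_scale)
      moreover have "w - (b / a) *s v \<in> H"
        using ab \<open>a \<noteq> 0\<close> by (simp add: hyperplane coord_diff coord_scale flip: iota_mult)
      ultimately have "w - (b / a) *s v \<in> \<pi>" using \<open>\<pi> = L \<inter> H\<close> by blast
      then have "\<Lambda> w - \<iota> (b / a) *s \<Lambda> v \<in> vec.span {x}"
        using x by (simp add: coord_diff coord_scale)
      then show ?thesis using vec.span_breakdown_eq by blast
    qed
    have "bb_point P \<in> {P \<in> pg_points. P \<subseteq> vec.span {\<Lambda> v, x}}" if "P \<in> l" for P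
    proof -
      have P: "P \<in> bb_points H S" "P \<subseteq> L" using that 2 by auto
      have "bb_point P \<subseteq> vec.span {\<Lambda> v, x}"
        unfolding bb_point_def using in_span P by (intro vec.span_minimal) auto
      then show ?thesis using bb_point_in_pg_points[OF P(1)] by simp
    qed
    then show ?thesis using pg_line_through(1)[OF v_nz x_notin] by blast
  qed
qed

text \<open>For a line \<open>M\<close> other than the line at infinity, the vectors with
  coordinates in \<open>M\<close> form a 3-space: a spread element, of dimension 3, and one further
  generator off \<open>H\<close>.\<close>

lemma pg_line_imp_bb_line:
  assumes "l' \<in> pg_lines"
  shows "\<exists>l\<in>bb_lines H S. {P \<in> bb_points H S. bb_point P \<in> l'} \<subseteq> l"
proof -
  obtain M where M: "M \<in> pg_spaces 1" and l': "l' = {P \<in> pg_points. P \<subseteq> M}"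
    using assms by (auto simp: pg_lines_def)
  have M_sub: "vec.subspace M" and M_dim: "vec.dim M = 2" using M by (auto simp: pg_spaces_def)
  show ?thesis
  proof (cases "M \<subseteq> {z. z $ 3 = 0}")
    case True
    have "P \<in> S" if "P \<in> bb_points H S" "bb_point P \<in> l'" for P
      using that(1)
    proof (cases rule: bb_points_cases)
      case (affine v)
      then have "\<Lambda> v \<in> M" using that l' vec.span_base by blast
      then show ?thesis using affine True by blast
    qed simp
    then show ?thesis by (auto simp: bb_lines_def)
  next
    case False
    then obtain m' where m': "m' \<in> M" "m' $ 3 \<noteq> 0" by blast
    \<comment> \<open>Scaled to third coordinate 1, which is rational, so that \<open>m\<close> is
      the coordinate vector of some \<open>v\<close>.\<close>
    define m where "m = inverse (m' $ 3) *s m'"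
    have m: "m \<in> M" "m $ 3 = 1" using m' M_sub by (auto simp: m_def vec.subspace_scale)
    then have "m \<noteq> 0" by auto
    have "\<not> M \<subseteq> vec.span {m}"
    proof
      assume "M \<subseteq> vec.span {m}"
      then have "vec.dim M \<le> card {m}" by (intro vec.dim_le_card) auto
      then show False using M_dim by simp
    qed
    then obtain n where n: "n \<in> M" "n \<notin> vec.span {m}" by blast
    define x where "x = n - n $ 3 *s m"
    have x: "x \<in> M" "x $ 3 = 0"
      using n m M_sub by (auto simp: x_def vec.subspace_diff vec.subspace_scale)
    have x_notin: "x \<notin> vec.span {m}"
    proof
      assume "x \<in> vec.span {m}"
      then have "x + n $ 3 *s m \<in> vec.span {m}"
        by (intro vec.span_add scale_mem_span_singleton)
      then show False using n by (simp add: x_def)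
    qed
    then have "x \<noteq> 0" using vec.span_zero by blast
    have M_eq: "vec.span {m, x} = M"
      using span_pair_eq_of_dim_2[OF M m(1) x(1) \<open>m \<noteq> 0\<close> x_notin] .
    obtain v where v: "\<Lambda> v = m" using m(2) ex_coord[of m] by (metis iota_one rangeI)
    define \<pi> where "\<pi> = {v. \<Lambda> v \<in> vec.span {x}}"
    define L where "L = {v. \<Lambda> v \<in> M}"
    have \<pi>: "\<pi> \<in> S" unfolding spread_iff \<pi>_def using x \<open>x \<noteq> 0\<close> by blast
    have \<pi>_sub: "vec.subspace \<pi>" unfolding \<pi>_def by (intro subspace_coord_vimage) simp
    have "\<pi> \<subseteq> L"
      unfolding \<pi>_def L_def using x M_sub vec.span_minimal[of "{x}" M] by auto
    have "v \<in> L" using v m by (simp add: L_def)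
    have "v \<notin> H" using v m by (simp add: hyperplane)
    have "v \<notin> \<pi>" using v m span_third_eq_0[OF x(2)] by (auto simp: \<pi>_def)
    have L_sub: "vec.subspace L" unfolding L_def by (intro subspace_coord_vimage M_sub)
    have "L = vec.span (insert v \<pi>)"
    proof (intro equalityI subsetI)
      fix w assume "w \<in> L"
      then have "\<Lambda> w \<in> vec.span {m, x}" by (simp add: L_def M_eq)
      then obtain a b where ab: "\<Lambda> w = a *s m + b *s x" using mem_span_pair by blast
      \<comment> \<open>The scalar \<open>a\<close>, a priori in GF(q^3), is the third coordinate of
        a vector in the range of \<open>\<Lambda>\<close> and hence rational.\<close>
      then have "\<Lambda> w $ 3 = a" using m x by simp
      then obtain c where c: "a = \<iota> c" using coord_third by metis
      have "\<Lambda> (w - c *s v) = b *s x"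
        by (simp add: coord_diff coord_scale v ab c)
      then have "w - c *s v \<in> \<pi>" by (simp add: \<pi>_def scale_mem_span_singleton)
      then have "w - c *s v \<in> vec.span \<pi>" by (rule vec.span_base)
      then show "w \<in> vec.span (insert v \<pi>)" using vec.span_breakdown_eq by blast
    next
      fix w assume "w \<in> vec.span (insert v \<pi>)"
      then show "w \<in> L"
        using vec.span_minimal[of "insert v \<pi>" L] \<open>v \<in> L\<close> \<open>\<pi> \<subseteq> L\<close> L_sub by auto
    qed
    moreover have "vec.dim (insert v \<pi>) = 4"
      using dim_spread_element[OF \<open>x \<noteq> 0\<close> x(2)] \<open>v \<notin> \<pi>\<close> \<pi>_sub
      by (simp add: vec.dim_insert vec.span_eq_iff[THEN iffD2] flip: \<pi>_def)
    ultimately have "L \<in> pg_spaces 3" using L_sub by (simp add: pg_spaces_def)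
    then have line: "{P \<in> bb_points H S. P \<subseteq> L} \<in> bb_lines H S"
      unfolding bb_lines_def using \<pi> \<open>\<pi> \<subseteq> L\<close> \<open>v \<in> L\<close> \<open>v \<notin> H\<close> by blast
    have "P \<subseteq> L" if "P \<in> bb_points H S" "bb_point P \<in> l'" for P
    proof -
      have "\<Lambda> ` P \<subseteq> M"
        using that(2) vec.span_superset[of "\<Lambda> ` P"] by (auto simp: l' bb_point_def)
      then show ?thesis by (auto simp: L_def)
    qed
    then show ?thesis by (intro bexI[OF _ line]) auto
  qed
qed

text \<open>Turns the two arbitrary isomorphisms into a single map to which
  \<open>semilinear\<close> applies. Collinearity is preserved because subplane lines are cut out by
  ambient lines, and reflected because an ambient line with two points in \<open>B\<close> cuts out
  a subplane line.\<close>

lemma plane_embedding_composition: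
  fixes \<phi> :: "('a ^ 7) set \<Rightarrow> ('b ^ 3) set" and \<psi> :: "('a ^ 3) set \<Rightarrow> ('b ^ 3) set"
  assumes \<phi>: "bruck_bose_iso H S \<phi>"
    and B: "B \<subseteq> pg_points"
    and \<psi>: "incidence_iso \<psi> pg_points pg_lines B (subplane_lines B)"
  shows "plane_embedding (\<lambda>P. bb_point (inv_into (bb_points H S) \<phi> (\<psi> P)))"
proof -
  let ?\<phi>' = "inv_into (bb_points H S) \<phi>"
  have \<phi>_bij: "bij_betw \<phi> (bb_points H S) pg_points" and \<phi>_lines: "(\<lambda>l. \<phi> ` l) ` bb_lines H S = pg_lines"
    using \<phi> by (auto simp: bruck_bose_iso_def incidence_iso_def)
  have \<psi>_bij: "bij_betw \<psi> pg_points B" and \<psi>_lines: "(\<lambda>l. \<psi> ` l) ` pg_lines = subplane_lines B"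
    using \<psi> by (auto simp: incidence_iso_def)
  have \<psi>_pt: "\<psi> x \<in> pg_points" if "x \<in> pg_points" for x
    using \<psi>_bij B that by (auto simp: bij_betw_def)
  have \<phi>'_pt: "?\<phi>' y \<in> bb_points H S" and \<phi>_\<phi>': "\<phi> (?\<phi>' y) = y" if "y \<in> pg_points" for y
    using \<phi>_bij that by (auto simp: bij_betw_def inv_into_into f_inv_into_f)
  have \<phi>'_\<phi>: "?\<phi>' (\<phi> x) = x" if "x \<in> bb_points H S" for x
    using \<phi>_bij that by (auto simp: bij_betw_def)
  have \<psi>_inj: "x = y" if "\<psi> x = \<psi> y" "x \<in> pg_points" "y \<in> pg_points" for x y
    using \<psi>_bij that by (auto simp: bij_betw_def dest: inj_onD)
  have bb_line_sub: "l \<subseteq> bb_points H S" if "l \<in> bb_lines H S" for l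
    using that by (auto simp: bb_lines_def bb_points_def)
  have pg_line_sub: "l \<subseteq> pg_points" if "l \<in> pg_lines" for l :: "('a ^ 3) set set"
    using that by (auto simp: pg_lines_def)
  show ?thesis
  proof
    show "inj_on (\<lambda>P. bb_point (?\<phi>' (\<psi> P))) pg_points"
    proof (rule inj_onI)
      fix x y :: "('a ^ 3) set"
      assume xy: "x \<in> pg_points" "y \<in> pg_points" "bb_point (?\<phi>' (\<psi> x)) = bb_point (?\<phi>' (\<psi> y))"
      then have "?\<phi>' (\<psi> x) = ?\<phi>' (\<psi> y)"
        using inj_on_bb_point \<phi>'_pt \<psi>_pt by (meson inj_onD)
      then show "x = y" using \<phi>_\<phi>' \<psi>_pt \<psi>_inj xy by metis
    qed
    show "(\<lambda>P. bb_point (?\<phi>' (\<psi> P))) ` pg_points \<subseteq> pg_points"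
      using bb_point_in_pg_points \<phi>'_pt \<psi>_pt by blast
  next
    fix l :: "('a ^ 3) set set" assume "l \<in> pg_lines"
    then have "\<psi> ` l \<in> subplane_lines B" using \<psi>_lines by blast
    then obtain m where m: "m \<in> pg_lines" "\<psi> ` l \<subseteq> m"
      unfolding subplane_lines_def by blast
    then have "m \<in> (\<lambda>l. \<phi> ` l) ` bb_lines H S" using \<phi>_lines by simp
    then obtain n where n: "n \<in> bb_lines H S" "m = \<phi> ` n" by blast
    have "?\<phi>' (\<psi> P) \<in> n" if "P \<in> l" for P
    proof -
      obtain R where "R \<in> n" "\<psi> P = \<phi> R" using \<open>P \<in> l\<close> m n by blast
      then show ?thesis using \<phi>'_\<phi> bb_line_sub[OF n(1)] by auto
    qed
    then show "\<exists>l'\<in>pg_lines. (\<lambda>P. bb_point (?\<phi>' (\<psi> P))) ` l \<subseteq> l'"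
      using bb_lines_imp_pg_line[OF n(1)] by blast
  next
    fix x y z :: "('a ^ 3) set" and l' :: "('b ^ 3) set set"
    assume pts: "x \<in> pg_points" "y \<in> pg_points" "z \<in> pg_points" and ne: "x \<noteq> y"
      and l': "l' \<in> pg_lines" and on: "bb_point (?\<phi>' (\<psi> x)) \<in> l'" "bb_point (?\<phi>' (\<psi> y)) \<in> l'"
      "bb_point (?\<phi>' (\<psi> z)) \<in> l'"
    obtain n where n: "n \<in> bb_lines H S" "{P \<in> bb_points H S. bb_point P \<in> l'} \<subseteq> n"
      using pg_line_imp_bb_line[OF l'] by blast
    have mem': "\<psi> w \<in> \<phi> ` n" if "w \<in> pg_points" "bb_point (?\<phi>' (\<psi> w)) \<in> l'" for w
    proof -
      have "?\<phi>' (\<psi> w) \<in> n" using that n(2) \<phi>'_pt[OF \<psi>_pt[OF that(1)]] by blast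
      then show ?thesis using \<phi>_\<phi>'[OF \<psi>_pt[OF that(1)]] by (metis imageI)
    qed
    have mem: "\<psi> x \<in> \<phi> ` n" "\<psi> y \<in> \<phi> ` n" "\<psi> z \<in> \<phi> ` n"
      using mem'[OF pts(1) on(1)] mem'[OF pts(2) on(2)] mem'[OF pts(3) on(3)] .
    have inB: "\<psi> x \<in> B" "\<psi> y \<in> B" "\<psi> z \<in> B" using \<psi>_bij pts by (auto simp: bij_betw_def)
    \<comment> \<open>The hypothesis \<open>x \<noteq> y\<close> of \<open>reflects\<close> is what
      provides two points of \<open>B\<close> on the line.\<close>
    have "card {\<psi> x, \<psi> y} \<le> card (\<phi> ` n \<inter> B)"
      using mem inB by (intro card_mono) auto
    moreover have "\<psi> x \<noteq> \<psi> y" using ne \<psi>_inj pts by blast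
    ultimately have "2 \<le> card (\<phi> ` n \<inter> B)" by simp
    moreover have "\<phi> ` n \<in> pg_lines"
      using imageI[OF n(1), of "\<lambda>l. \<phi> ` l"] unfolding \<phi>_lines .
    ultimately have "\<phi> ` n \<inter> B \<in> subplane_lines B"
      unfolding subplane_lines_def by blast
    then obtain l where l: "l \<in> pg_lines" "\<phi> ` n \<inter> B = \<psi> ` l"
      unfolding \<psi>_lines[symmetric] by (elim imageE)
    have "w \<in> l" if "w \<in> pg_points" "\<psi> w \<in> \<phi> ` n" "\<psi> w \<in> B" for w
      using that l(2) \<psi>_inj pg_line_sub[OF l(1)] by (metis IntI imageE subsetD)
    then show "\<exists>l\<in>pg_lines. x \<in> l \<and> y \<in> l \<and> z \<in> l" using l(1) mem inB pts by blast
  qed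
qed

end

section \<open>Normal rational curves\<close>

lemma inj_on_and_independent_if_coeffs_zero:
  fixes d :: "nat \<Rightarrow> 'a::field ^ 'n"
  assumes zero: "\<And>l j. (\<Sum>j\<le>k. l j *s d j) = 0 \<Longrightarrow> j \<le> k \<Longrightarrow> l j = 0"
  shows "inj_on d {..k}" and "vec.independent (d ` {..k})"
proof -
  show inj: "inj_on d {..k}"
  proof (rule inj_onI, rule ccontr)
    fix i j assume ij: "i \<in> {..k}" "j \<in> {..k}" "d i = d j" "i \<noteq> j"
    let ?l = "\<lambda>m. if m = i then 1 else if m = j then - 1 else 0 :: 'a"
    have "(\<Sum>m\<le>k. ?l m *s d m) = (\<Sum>m\<in>{i, j}. ?l m *s d m)"
      using ij by (intro sum.mono_neutral_right) auto
    also have "\<dots> = 0" using ij by simp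
    finally have "?l i = 0" using zero[of ?l i] ij by blast
    then show False by simp
  qed
  show "vec.independent (d ` {..k})"
  proof (rule vec.independent_if_scalars_zero)
    fix f x assume "(\<Sum>x\<in>d ` {..k}. f x *s x) = 0" and x: "x \<in> d ` {..k}"
    then have "(\<Sum>j\<le>k. f (d j) *s d j) = 0"
      by (simp add: sum.reindex[OF inj])
    then show "f x = 0" using zero[of "\<lambda>j. f (d j)"] x by auto
  qed simp
qed

section \<open>Linear functionals on products with a quadratic polynomial\<close>

lemma sum_coeff_pCons_0:
  fixes L :: "nat \<Rightarrow> 'b::comm_ring_1"
  shows "(\<Sum>j\<le>Suc m. coeff (pCons 0 q) j * L j) = (\<Sum>j\<le>m. coeff q j * L (Suc j))"
  by (simp add: sum.atMost_Suc_shift del: sum.atMost_Suc)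

text \<open>Reading \<open>L\<close> as the functional sending X^j to \<open>L j\<close>, this is
  linearity on (x + yX + zX^2) p.\<close>

lemma sum_coeff_quadratic_mult:
  fixes p :: "'b::field poly"
  shows "(\<Sum>j\<le>degree p + 2. coeff ([:x, y, z:] * p) j * L j) =
    x * (\<Sum>j\<le>degree p. coeff p j * L j) + y * (\<Sum>j\<le>degree p. coeff p j * L (1 + j)) +
    z * (\<Sum>j\<le>degree p. coeff p j * L (2 + j))"
proof -
  have extend: "(\<Sum>j\<le>degree p + r. coeff p j * L' j) = (\<Sum>j\<le>degree p. coeff p j * L' j)" for r L'
    by (intro sum.mono_neutral_right) (auto simp: coeff_eq_0)
  have "[:x, y, z:] * p = smult x p + pCons 0 (smult y p + pCons 0 (smult z p))"
    by simp
  then have "(\<Sum>j\<le>degree p + 2. coeff ([:x, y, z:] * p) j * L j) =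
      (\<Sum>j\<le>degree p + 2. coeff (smult x p) j * L j) +
      ((\<Sum>j\<le>Suc (degree p). coeff (smult y p) j * L (Suc j)) +
      (\<Sum>j\<le>degree p. coeff (smult z p) j * L (Suc (Suc j))))"
    using sum_coeff_pCons_0[of "smult y p + pCons 0 (smult z p)" L "Suc (degree p)"]
      sum_coeff_pCons_0[of "smult z p" "\<lambda>j. L (Suc j)" "degree p"]
    by (simp add: sum.distrib distrib_right del: sum.atMost_Suc)
  also have "(\<Sum>j\<le>degree p + 2. coeff (smult x p) j * L j) = x * (\<Sum>j\<le>degree p. coeff p j * L j)"
    unfolding extend[where r = 2 and L' = L, symmetric] by (simp only: coeff_smult mult.assoc sum_distrib_left)
  also have "(\<Sum>j\<le>Suc (degree p). coeff (smult y p) j * L (Suc j)) =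
      y * (\<Sum>j\<le>degree p. coeff p j * L (1 + j))"
    using extend[where r = 1 and L' = "\<lambda>j. L (Suc j)", symmetric]
    by (simp only: coeff_smult mult.assoc sum_distrib_left[symmetric] plus_1_eq_Suc Suc_eq_plus1[symmetric])
  finally show ?thesis
    by (simp add: sum_distrib_left mult.assoc add.assoc)
qed

lemma coeff_quadratic_mult_top:
  fixes p :: "'b::field poly"
  assumes "lead_coeff p = 1"
  shows "coeff ([:x, y, z:] * p) (degree p + 2) = z"
  using assms by (simp add: coeff_pCons_cases coeff_eq_0)

lemma poly_eq_sum_atMost:
  fixes p :: "'b::comm_ring_1 poly"
  assumes "degree p \<le> k"
  shows "poly p x = (\<Sum>j\<le>k. x ^ j * coeff p j)"
proof -
  have "poly p x = (\<Sum>j\<le>degree p. x ^ j * coeff p j)"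
    by (simp add: poly_altdef mult.commute)
  also have "\<dots> = (\<Sum>j\<le>k. x ^ j * coeff p j)"
    using assms by (intro sum.mono_neutral_left) (auto simp: coeff_eq_0)
  finally show ?thesis .
qed

context bb_coordinates
begin

text \<open>Serves a conic with empty affine part: any three independent vectors of \<open>H\<close>
  carry a conic inside \<open>H\<close>.\<close>

lemma normal_rational_curve_at_infinity:
  "\<exists>N. normal_rational_curve 2 N \<and> N \<inter> affine_points H = {}"
proof -
  obtain B where B: "B \<subseteq> H" "vec.independent B" "card B = 6"
    using vec.basis_exists[of H] dim_hyperplane by metis
  obtain B' where B': "B' \<subseteq> B" "card B' = 3"
    using obtain_subset_with_card_n[of 3 B] B(3) by auto
  then obtain b where b: "bij_betw b {..2 :: nat} B'"
    using finite_same_card_bij[of "{..2 :: nat}" B'] by (metis card_atMost card_gt_0_iff finite_atMost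
        numeral_2_eq_2 numeral_3_eq_3 zero_less_Suc)
  have ind: "vec.independent B'" using B(2) B'(1) vec.independent_mono by blast
  have b_img: "b ` {..2} = B'" and b_inj: "inj_on b {..2}" using b by (auto simp: bij_betw_def)
  define N where "N = point_of_coords 2 b ` ({\<lambda>i. \<theta> ^ i | \<theta>. True} \<union> {\<lambda>i. if i = 2 then 1 else 0})"
  have "vec.dim (vec.span B') = 3"
    using vec.dim_span_eq_card_independent[OF ind] B'(2) by simp
  then have "vec.span B' \<in> pg_spaces 2" by (simp add: pg_spaces_def)
  then have "normal_rational_curve 2 N"
    unfolding normal_rational_curve_def N_def using ind b_img b_inj by blast
  moreover have "point_of_coords 2 b c \<subseteq> H" for c
  proof -
    have "b i \<in> H" if "i \<le> 2" for i using that b_img B'(1) B(1) by blast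
    then have "(\<Sum>i\<le>2. c i *s b i) \<in> H"
      using subspace_hyperplane by (intro vec.subspace_sum vec.subspace_scale) auto
    then show ?thesis
      unfolding point_of_coords_def using subspace_hyperplane by (intro vec.span_minimal) auto
  qed
  then have "N \<inter> affine_points H = {}" by (auto simp: N_def affine_points_def)
  ultimately show ?thesis by blast
qed

text \<open>The third coordinate of the parametrization is g, monic because
  \<open>a2 $ 3 = 1\<close>. Multiplying by p changes no point, as p has no rational root, and makes
  all coefficient vectors coordinates of vectors over GF(q).\<close>

lemma affine_part_eq_normal_rational_curve:
  assumes ind: "indep3 a0 a1 a2" and a2: "a2 $ 3 = 1"
  shows "\<exists>k\<in>{2, 3, 4, 6}. \<exists>N. normal_rational_curve k N \<and>
    N \<inter> affine_points H = {P \<in> affine_points H. bb_point P = vec.span {a2} \<or>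
      (\<exists>t. bb_point P = vec.span {a0 + \<iota> t *s a1 + \<iota> t ^ 2 *s a2})}"
proof -
  obtain k p where k: "k \<in> {2, 3, 4, 6}" and clears: "clears_denominator k [:a0 $ 3, a1 $ 3, 1:] p"
    using ex_clears_denominator by blast
  have k_eq: "k = degree p + 2" and monic: "lead_coeff p = 1"
    and no_root: "\<And>t. poly p (\<iota> t) \<noteq> 0"
    and rat: "\<And>j. coeff ([:a0 $ 3, a1 $ 3, 1:] * p) j \<in> range \<iota>"
    and kill: "\<And>l. (\<forall>i\<le>2. (\<Sum>j\<le>degree p. coeff p j * \<iota> (l (i + j))) = 0) \<Longrightarrow> \<forall>j\<le>k. l j = 0"
    using clears unfolding clears_denominator_def by auto
  define A where "A i = [:a0 $ i, a1 $ i, a2 $ i:]" for i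
  define cf where "cf j = (\<chi> i. coeff (A i * p) j)" for j
  define a where "a t = a0 + \<iota> t *s a1 + \<iota> t ^ 2 *s a2" for t
  \<comment> \<open>The third coordinates are the coefficients of g p, and rationality there is all
    that the range of \<open>\<Lambda>\<close> demands.\<close>
  have "\<exists>v. \<Lambda> v = cf j" for j
    using rat[of j] a2 by (intro ex_coord) (simp add: cf_def A_def)
  then obtain d where d: "\<And>j. \<Lambda> (d j) = cf j" by metis
  \<comment> \<open>As p is monic, the leading coefficient vector is unchanged, so the point of
    \<open>N\<close> at parameter infinity represents \<open>a2\<close>.\<close>
  have cf_top: "cf k = a2"
    unfolding vec_eq_iff cf_def A_def k_eq by (simp only: vec_lambda_beta coeff_quadratic_mult_top[OF monic]) simp
  have curve: "\<Lambda> (\<Sum>j\<le>k. t ^ j *s d j) = poly p (\<iota> t) *s a t" for t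
  proof -
    have "degree (A i * p) \<le> k" for i
    proof -
      have "degree (A i * p) \<le> degree (A i) + degree p" by (rule degree_mult_le)
      moreover have "degree (A i) \<le> 2" by (simp add: A_def)
      ultimately show ?thesis by (simp add: k_eq)
    qed
    then have "(\<Sum>j\<le>k. \<iota> t ^ j * coeff (A i * p) j) = poly p (\<iota> t) * a t $ i" for i
      using poly_eq_sum_atMost[of "A i * p" k "\<iota> t"]
      by (simp add: A_def a_def algebra_simps power2_eq_square)
    then show ?thesis
      by (simp add: vec_eq_iff coord_sum coord_scale d cf_def iota_power)
  qed
  have zero: "l j = 0" if l: "(\<Sum>j\<le>k. l j *s d j) = 0" and j: "j \<le> k" for l :: "nat \<Rightarrow> 'a" and j
  proof -
    \<comment> \<open>The value at X^m p of the functional given by \<open>l\<close>. Independence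
      of \<open>a0\<close>, \<open>a1\<close>, \<open>a2\<close> makes the values for m <= 2 vanish,
      as \<open>kill\<close> requires.\<close>
    define X where "X m = (\<Sum>j\<le>degree p. coeff p j * \<iota> (l (m + j)))" for m
    have "(\<Sum>j\<le>k. \<iota> (l j) *s cf j) = 0"
      using arg_cong[OF l, of \<Lambda>] by (simp add: coord_sum coord_scale d)
    then have "(\<Sum>j\<le>k. coeff (A i * p) j * \<iota> (l j)) = 0" for i
      by (simp add: vec_eq_iff cf_def mult.commute)
    then have "a0 $ i * X 0 + a1 $ i * X 1 + a2 $ i * X 2 = 0" for i
      using sum_coeff_quadratic_mult[where p = p and x = "a0 $ i" and y = "a1 $ i" and z = "a2 $ i"
          and L = "\<lambda>j. \<iota> (l j)"]
      by (simp add: A_def X_def k_eq)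
    then have "X 0 *s a0 + X 1 *s a1 + X 2 *s a2 = 0"
      by (simp add: vec_eq_iff mult.commute)
    then have "X 0 = 0 \<and> X 1 = 0 \<and> X 2 = 0" using ind unfolding indep3_def by blast
    moreover have "i = 0 \<or> i = 1 \<or> i = 2" if "i \<le> 2" for i :: nat using that by linarith
    ultimately have "\<forall>i\<le>2. X i = 0" by metis
    then show ?thesis using kill[of l] j unfolding X_def by blast
  qed
  have indep_d: "inj_on d {..k}" "vec.independent (d ` {..k})"
    by (rule inj_on_and_independent_if_coeffs_zero; use zero in blast)+
  define N where "N = point_of_coords k d ` ({\<lambda>i. \<theta> ^ i | \<theta>. True} \<union> {\<lambda>i. if i = k then 1 else 0})"
  have "vec.dim (vec.span (d ` {..k})) = k + 1"
    using vec.dim_span_eq_card_independent[OF indep_d(2)] card_image[OF indep_d(1)] by simp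
  then have "vec.span (d ` {..k}) \<in> pg_spaces k" by (simp add: pg_spaces_def)
  then have nrc: "normal_rational_curve k N"
    unfolding normal_rational_curve_def N_def using indep_d by blast
  have "(\<Sum>i\<le>k. (if i = k then 1 else 0) *s d i) = d k"
    by (simp add: if_distrib[of "\<lambda>x. x *s _"] cong: if_cong)
  then have N_iff: "P \<in> N \<longleftrightarrow> P = vec.span {d k} \<or> (\<exists>t. P = vec.span {\<Sum>j\<le>k. t ^ j *s d j})" for P
    by (auto simp: N_def point_of_coords_def)
  have bb_top: "bb_point (vec.span {d k}) = vec.span {a2}"
    by (simp add: bb_point_span_singleton d cf_top)
  have bb_curve: "bb_point (vec.span {\<Sum>j\<le>k. t ^ j *s d j}) = vec.span {a t}" for t
    using no_root by (simp add: bb_point_span_singleton curve span_scale_singleton)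
  \<comment> \<open>The vector \<open>w\<close> may lie in \<open>H\<close>, where
    \<open>bb_point\<close> does not separate points; equality with the image of an affine point
    rules this out.\<close>
  have unique: "P = vec.span {w}" if P: "P \<in> affine_points H" and eq: "bb_point P = bb_point (vec.span {w})" for P w
  proof -
    obtain v where v: "v \<notin> H" "P = vec.span {v}" using P affine_points_iff by blast
    then have spans: "vec.span {\<Lambda> v} = vec.span {\<Lambda> w}" using eq by (simp add: bb_point_span_singleton)
    then have "\<Lambda> v \<in> vec.span {\<Lambda> w}" using vec.span_base by blast
    then obtain c where "\<Lambda> v = c *s \<Lambda> w" by (auto simp: vec.span_singleton)
    then have "\<Lambda> w $ 3 \<noteq> 0" using v by (auto simp: hyperplane)
    then show ?thesis using affine_point_eq[OF _ _ spans] v by (simp add: hyperplane)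
  qed
  have "N \<inter> affine_points H = {P \<in> affine_points H. bb_point P = vec.span {a2} \<or>
      (\<exists>t. bb_point P = vec.span {a t})}"
  proof (intro equalityI subsetI)
    fix P assume P: "P \<in> N \<inter> affine_points H"
    then consider "P = vec.span {d k}" | t where "P = vec.span {\<Sum>j\<le>k. t ^ j *s d j}"
      using N_iff by blast
    then have "bb_point P = vec.span {a2} \<or> (\<exists>t. bb_point P = vec.span {a t})"
      by cases (use bb_top bb_curve in blast)+
    then show "P \<in> {P \<in> affine_points H. bb_point P = vec.span {a2} \<or>
      (\<exists>t. bb_point P = vec.span {a t})}" using P by simp
  next
    fix P assume "P \<in> {P \<in> affine_points H. bb_point P = vec.span {a2} \<or>
      (\<exists>t. bb_point P = vec.span {a t})}"
    then have P: "P \<in> affine_points H"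
      and "bb_point P = vec.span {a2} \<or> (\<exists>t. bb_point P = vec.span {a t})" by auto
    then consider "bb_point P = bb_point (vec.span {d k})"
      | t where "bb_point P = bb_point (vec.span {\<Sum>j\<le>k. t ^ j *s d j})"
      unfolding bb_top bb_curve by blast
    then have "P \<in> N"
      unfolding N_iff by cases (use unique[OF P] in blast)+
    then show "P \<in> N \<inter> affine_points H" using P by simp
  qed
  then show ?thesis using k nrc unfolding a_def by blast
qed

lemma affine_point_not_in_spread: "P \<in> affine_points H \<Longrightarrow> P \<notin> S"
proof
  assume "P \<in> affine_points H" and "P \<in> S"
  then obtain x where "x $ 3 = 0" "P = {v. \<Lambda> v \<in> vec.span {x}}" using spread_iff by blast
  then have "P \<subseteq> H" using span_third_eq_0[of x] by (auto simp: hyperplane)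
  then show False using \<open>P \<in> affine_points H\<close> by (simp add: affine_points_def)
qed

text \<open>Replaces comparison through the unknown \<open>\<phi>\<close> by comparison through
  \<open>bb_point\<close>, using that both are injective on the points of the Bruck-Bose
  plane.\<close>

lemma bb_affine_rep_iff:
  assumes \<phi>: "bruck_bose_iso H S \<phi>" and D: "\<psi> ` D \<subseteq> pg_points"
  shows "P \<in> bb_affine_rep H S \<phi> (\<psi> ` D) \<longleftrightarrow>
    P \<in> affine_points H \<and> (\<exists>R\<in>D. bb_point P = bb_point (inv_into (bb_points H S) \<phi> (\<psi> R)))"
proof -
  let ?\<phi>' = "inv_into (bb_points H S) \<phi>"
  have \<phi>_bij: "bij_betw \<phi> (bb_points H S) pg_points"
    using \<phi> by (auto simp: bruck_bose_iso_def incidence_iso_def)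
  have \<phi>'_pt: "?\<phi>' y \<in> bb_points H S" and \<phi>_\<phi>': "\<phi> (?\<phi>' y) = y" if "y \<in> pg_points" for y
    using \<phi>_bij that by (auto simp: bij_betw_def inv_into_into f_inv_into_f)
  have \<phi>_inj: "inj_on \<phi> (bb_points H S)" using \<phi>_bij by (simp add: bij_betw_def)
  show ?thesis
  proof (cases "P \<in> affine_points H")
    case True
    then have P: "P \<in> bb_points H S" by (simp add: bb_points_def)
    have "\<phi> P \<notin> \<phi> ` S"
      using affine_point_not_in_spread[OF True] P \<phi>_inj by (auto simp: bb_points_def dest: inj_onD)
    moreover have "\<phi> P = \<psi> R \<longleftrightarrow> bb_point P = bb_point (?\<phi>' (\<psi> R))" if "R \<in> D" for R
    proof -
      have R: "\<psi> R \<in> pg_points" using D that by blast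
      have "\<phi> P = \<psi> R \<longleftrightarrow> P = ?\<phi>' (\<psi> R)"
        using \<phi>_inj P \<phi>_\<phi>'[OF R] by (metis inv_into_f_f)
      also have "\<dots> \<longleftrightarrow> bb_point P = bb_point (?\<phi>' (\<psi> R))"
        using inj_onD[OF inj_on_bb_point _ P \<phi>'_pt[OF R]] by metis
      finally show ?thesis .
    qed
    ultimately show ?thesis using True unfolding bb_affine_rep_def by blast
  qed (simp add: bb_affine_rep_def)
qed

lemma Fq_conic_represents_nrc:
  fixes C :: "('b ^ 3) set set"
  assumes \<phi>: "bruck_bose_iso H S \<phi>" and C: "Fq_conic TYPE('a) C"
  shows "\<exists>k\<in>{2, 3, 4, 6}. bb_represents_nrc k H S \<phi> C"
proof -
  obtain B and \<psi> :: "('a ^ 3) set \<Rightarrow> ('b ^ 3) set" and D where B: "subplane_of_order CARD('a) B"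
    and \<psi>: "incidence_iso \<psi> pg_points pg_lines B (subplane_lines B)"
    and D: "nondegenerate_conic D" and C_eq: "C = \<psi> ` D"
    using C unfolding Fq_conic_def by blast
  obtain Q where Q: "quadratic_form Q" "nondegenerate_form Q" and D_eq: "D = zero_locus Q"
    using D unfolding nondegenerate_conic_def by blast
  have B_pts: "B \<subseteq> pg_points" using B by (simp add: subplane_of_order_def)
  have D_pts: "D \<subseteq> pg_points" by (auto simp: D_eq zero_locus_def)
  then have "\<psi> ` D \<subseteq> pg_points"
    using \<psi> B_pts by (auto simp: incidence_iso_def bij_betw_def)
  note rep_iff = bb_affine_rep_iff[OF \<phi> this, folded C_eq]
  define \<Psi> where "\<Psi> R = bb_point (inv_into (bb_points H S) \<phi> (\<psi> R))" for R
  interpret plane_embedding \<Psi>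
    unfolding \<Psi>_def using plane_embedding_composition[OF \<phi> B_pts \<psi>] .
  show ?thesis
  proof (cases "bb_affine_rep H S \<phi> C = {}")
    case True
    then have "bb_represents_nrc 2 H S \<phi> C"
      using normal_rational_curve_at_infinity unfolding bb_represents_nrc_def by metis
    then show ?thesis by blast
  next
    case False
    \<comment> \<open>A point of the conic with affine image; the parametrization is based at it so
      that it gets parameter infinity.\<close>
    then obtain P0 R0 where P0: "P0 \<in> affine_points H" and R0: "R0 \<in> D" "bb_point P0 = \<Psi> R0"
      using rep_iff unfolding \<Psi>_def by blast
    obtain p where p: "p \<noteq> 0" "R0 = vec.span {p}" using R0 D_pts mem_pg_points by blast
    have "vec.span {p} \<in> zero_locus Q" using R0(1) p(2) D_eq by simp
    note param = conic_parametrization[OF Q p(1) this, folded D_eq]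
    obtain e0 e1 e2 where e: "indep3 e0 e1 e2" and e2: "vec.span {e2} = vec.span {p}"
      and D_param: "D = insert (vec.span {e2}) (range (\<lambda>t. vec.span {e0 + t *s e1 + t ^ 2 *s e2}))"
      using param by (elim exE conjE)
    obtain \<sigma> :: "'a \<Rightarrow> 'b" and M :: "'a ^ 3 \<Rightarrow> 'b ^ 3" where \<sigma>: "field_embedding \<sigma>"
      and M_add: "\<And>x y. M (x + y) = M x + M y" and M_scale: "\<And>c x. M (c *s x) = \<sigma> c *s M x"
      and M_indep: "\<And>u v w. indep3 u v w \<Longrightarrow> indep3 (M u) (M v) (M w)"
      and M: "\<And>x. x \<noteq> 0 \<Longrightarrow> \<Psi> (vec.span {x}) = vec.span {M x}"
      using semilinear by metis
    interpret \<sigma>: cubic_extension \<sigma>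
      using \<sigma> card_ext by unfold_locales
    \<comment> \<open>Semilinearity produces the parameter \<open>\<sigma> t\<close>, the curve
      lemma uses \<open>\<iota> t\<close>; both run through the fixed field of Frobenius.\<close>
    have "range \<sigma> = range \<iota>"
      unfolding range_iota \<sigma>.range_iota fr_def \<sigma>.fr_def ..
    then have range: "(\<exists>t. F (\<sigma> t)) \<longleftrightarrow> (\<exists>t. F (\<iota> t))" for F
      by (metis rangeE rangeI)
    have e_nz: "e2 \<noteq> 0" "e0 + t *s e1 + t ^ 2 *s e2 \<noteq> 0" for t
      using e[unfolded indep3_def, rule_format, of 0 0 1] e[unfolded indep3_def, rule_format, of 1 t "t ^ 2"]
      by auto
    \<comment> \<open>Nonzero because \<open>e2\<close> represents the affine point
      \<open>P0\<close>; dividing by it gives third coordinate 1.\<close>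
    define z where "z = M e2 $ 3"
    have "z \<noteq> 0"
    proof
      assume "z = 0"
      obtain v where v: "v \<notin> H" "P0 = vec.span {v}" using P0 affine_points_iff by blast
      then have "vec.span {\<Lambda> v} = vec.span {M e2}"
        using R0 M[OF e_nz(1)] by (simp add: bb_point_span_singleton p e2)
      then have "\<Lambda> v \<in> vec.span {M e2}" using vec.span_base by blast
      then show False
        using span_third_eq_0[of "M e2"] \<open>z = 0\<close> v by (auto simp: z_def hyperplane)
    qed
    define a where "a x = inverse z *s M x" for x
    have a_indep: "indep3 (a e0) (a e1) (a e2)"
      unfolding indep3_def
    proof (intro allI impI)
      fix c0 c1 c2 assume "c0 *s a e0 + c1 *s a e1 + c2 *s a e2 = 0"
      then have "(c0 * inverse z) *s M e0 + (c1 * inverse z) *s M e1 + (c2 * inverse z) *s M e2 = 0"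
        by (simp add: a_def)
      then have "c0 * inverse z = 0 \<and> c1 * inverse z = 0 \<and> c2 * inverse z = 0"
        using M_indep[OF e] unfolding indep3_def by blast
      then show "c0 = 0 \<and> c1 = 0 \<and> c2 = 0" using \<open>z \<noteq> 0\<close> by simp
    qed
    have a_span: "vec.span {M x} = vec.span {a x}" for x
      using \<open>z \<noteq> 0\<close> by (simp add: a_def span_scale_singleton)
    have a_curve: "a (e0 + t *s e1 + t ^ 2 *s e2) = a e0 + \<sigma> t *s a e1 + \<sigma> t ^ 2 *s a e2" for t
      by (simp add: a_def M_add M_scale \<sigma>.iota_power vec.scale_right_distrib mult.commute)
    have "a e2 $ 3 = 1" using \<open>z \<noteq> 0\<close> by (simp add: a_def z_def)
    then obtain k N where k: "k \<in> {2, 3, 4, 6}" and N: "normal_rational_curve k N"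
      "N \<inter> affine_points H = {P \<in> affine_points H. bb_point P = vec.span {a e2} \<or>
        (\<exists>t. bb_point P = vec.span {a e0 + \<iota> t *s a e1 + \<iota> t ^ 2 *s a e2})}"
      using affine_part_eq_normal_rational_curve[OF a_indep] by blast
    have "(\<exists>R\<in>D. bb_point P = \<Psi> R) \<longleftrightarrow> bb_point P = vec.span {a e2} \<or>
        (\<exists>t. bb_point P = vec.span {a e0 + \<iota> t *s a e1 + \<iota> t ^ 2 *s a e2})" for P
      unfolding D_param
      using M e_nz a_span a_curve
        range[of "\<lambda>x. bb_point P = vec.span {a e0 + x *s a e1 + x ^ 2 *s a e2}"] by simp
    then have "N \<inter> affine_points H = bb_affine_rep H S \<phi> C"
      unfolding N set_eq_iff rep_iff mem_Collect_eq \<Psi>_def by blast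
    then show ?thesis using k N(1) unfolding bb_represents_nrc_def by blast
  qed
qed

end

theorem corollary4p7:
  fixes q :: nat
    and \<iota> :: "'a::{field,finite} \<Rightarrow> 'b::{field,finite}"
    and H :: "('a ^ 7) set"
    and S :: "('a ^ 7) set set"
    and \<phi> :: "('a ^ 7) set \<Rightarrow> ('b ^ 3) set"
    and C :: "('b ^ 3) set set"
  assumes "CARD('a) = q" and "CARD('b) = q ^ 3" and "6 \<le> q"
    and "field_embedding \<iota>"
    and "H \<in> pg_spaces 5"
    and "regular_2_spread \<iota> H S"
    and "bruck_bose_iso H S \<phi>"
    and "Fq_conic TYPE('a) C"
  shows "\<exists>k\<in>{2, 3, 4, 6}. bb_represents_nrc k H S \<phi> C"
proof -
  interpret cubic_extension \<iota>
    using assms by unfold_locales auto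
  obtain \<Lambda> where "bb_coordinates \<iota> H S \<Lambda>"
    using ex_bb_coordinates assms by blast
  then show ?thesis
    using assms by (intro bb_coordinates.Fq_conic_represents_nrc)
qed

end
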